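(* Let $n=\prod_i p_i^{r_i}$ be a composite positive integer, with distinct primes $p_i$ and $r_i\ge1$. For each $i$ set $$g_i=\gcd(n-1,p_i-1),\qquad h_i=\gcd(n-1,p_i^2-1),$$ $$A_i=\tfrac12\left(g_i^2-g_i\right),\qquad B_i=\tfrac12\left(h_i-g_i\right).$$ Then $$L_2^+(n)=\frac12\prod_i (A_i+B_i)+\frac12\prod_{i:\,2\mid r_i}(A_i+B_i)\prod_{i:\,2\nmid r_i}(A_i-B_i).$$
   Context: For a positive integer $m$ and monic $g_1,g_2,h\in(\mathbb{Z}/m\mathbb{Z})[x]$, $\mathrm{gcmd}(g_1,g_2)=h$ means that the ideal generated by $g_1,g_2$ in $(\mathbb{Z}/m\mathbb{Z})[x]$ equals the ideal generated by $h$. A composite $n$ is a degree-2 Frobenius pseudoprime with respect to a monic quadratic $f$ with discriminant $\Delta$ (equivalently, $f$ is a liar for $n$) if all of the following hold: (1) $\gcd(n,f(0)\Delta)=1$; (2) modulo $n$, the polynomials $F_1=\mathrm{gcmd}(x^n-x,f)$, $f_1=f/F_1$, $F_2=\mathrm{gcmd}(x^{n^2}-x,f_1)$ and $f_2=f_1/F_2$ all exist, and $f_2=1$; (3) $F_2(x)\mid F_2(x^n)$; (4) $(-1)^{\deg(F_2)/2}=\left(\frac{\Delta}{n}\right)$ (Jacobi symbol). These conditions depend only on $f$ modulo $n$. $L_2^+(n)$ is the number of monic quadratic polynomials $f\in(\mathbb{Z}/n\mathbb{Z})[x]$ that are liars for $n$ and satisfy $\left(\frac{\Delta}{n}\right)=+1$.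 *)

theory Defs
  imports
    "HOL-Number_Theory.Number_Theory"
    "HOL-Algebra.UnivPoly"
    "HOL-Algebra.Divisibility"
    "HOL-Computational_Algebra.Polynomial"
begin

hide_const (open) Divisibility.prime

abbreviation Zmod :: "nat \<Rightarrow> int ring" where
  "Zmod m \<equiv> residue_ring (int m)"

abbreviation ZmodX :: "nat \<Rightarrow> (int, nat \<Rightarrow> int) up_ring" where
  "ZmodX m \<equiv> UP (Zmod m)"

definition reduce_poly :: "nat \<Rightarrow> int poly \<Rightarrow> nat \<Rightarrow> int" where
  "reduce_poly m f = (\<lambda>i. Polynomial.coeff f i mod int m)"

definition monic_mod :: "nat \<Rightarrow> (nat \<Rightarrow> int) \<Rightarrow> bool" where
  "monic_mod m g \<longleftrightarrow> g \<in> carrier (ZmodX m) \<and>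
     up_ring.coeff (ZmodX m) g (deg (Zmod m) g) = \<one>\<^bsub>Zmod m\<^esub>"

definition X_pow :: "nat \<Rightarrow> nat \<Rightarrow> nat \<Rightarrow> int" where
  "X_pow m k = up_ring.monom (ZmodX m) \<one>\<^bsub>Zmod m\<^esub> k"

text \<open>The greatest common monic divisor need not exist, and is unique if it does; hence a relation.\<close>

definition is_gcmd :: "nat \<Rightarrow> (nat \<Rightarrow> int) \<Rightarrow> (nat \<Rightarrow> int) \<Rightarrow> (nat \<Rightarrow> int) \<Rightarrow> bool" where
  "is_gcmd m g\<^sub>1 g\<^sub>2 h \<longleftrightarrow> monic_mod m g\<^sub>1 \<and> monic_mod m g\<^sub>2 \<and> monic_mod m h \<and>
     Idl\<^bsub>ZmodX m\<^esub> {g\<^sub>1, g\<^sub>2} = Idl\<^bsub>ZmodX m\<^esub> {h}"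

definition subst_X_pow :: "nat \<Rightarrow> (nat \<Rightarrow> int) \<Rightarrow> nat \<Rightarrow> nat \<Rightarrow> int" where
  "subst_X_pow m g k =
     eval (Zmod m) (ZmodX m) (\<lambda>a. up_ring.monom (ZmodX m) a 0) (X_pow m k) g"

definition quadratic_discr :: "int poly \<Rightarrow> int" where
  "quadratic_discr f =
     (Polynomial.coeff f 1)\<^sup>2 - 4 * Polynomial.coeff f 2 * Polynomial.coeff f 0"

text \<open>The Jacobi symbol for odd \<open>n\<close>. The case \<open>p = 2\<close> is Kronecker's convention; it only
  matters for even \<open>n\<close>, where the Jacobi symbol proper is undefined.\<close>

definition jacobi :: "int \<Rightarrow> nat \<Rightarrow> int" where
  "jacobi a n = (\<Prod>p\<in>prime_factors n.
     (if p = 2 then (if even a then 0 else if a mod 8 \<in> {1, 7} then 1 else -1)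
      else Legendre a (int p)) ^ multiplicity p n)"

text \<open>Here \<open>f\<close> has integer coefficients and is reduced modulo \<open>n\<close>. The quotients
  \<open>f\<^sub>1 = f / F\<^sub>1\<close> and \<open>f\<^sub>2 = f\<^sub>1 / F\<^sub>2\<close> are expressed by exact products; they are unique because the
  divisors are monic. If \<open>deg F\<^sub>2\<close> is odd, then \<open>(-1)\<close> to the power \<open>deg F\<^sub>2 / 2\<close> is not a real
  number and hence not a value of the Jacobi symbol, so evenness of the degree is part of the
  last condition.\<close>

definition frobenius_pseudoprime2 :: "nat \<Rightarrow> int poly \<Rightarrow> bool" where
  "frobenius_pseudoprime2 n f \<longleftrightarrow>
     n > 1 \<and> \<not> prime n \<and> Polynomial.degree f = 2 \<and> lead_coeff f = 1 \<and>
     gcd (int n) (poly f 0 * quadratic_discr f) = 1 \<and>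
     (\<exists>F\<^sub>1 f\<^sub>1 F\<^sub>2 f\<^sub>2.
        is_gcmd n (X_pow n n \<ominus>\<^bsub>ZmodX n\<^esub> X_pow n 1) (reduce_poly n f) F\<^sub>1 \<and>
        f\<^sub>1 \<in> carrier (ZmodX n) \<and> reduce_poly n f = F\<^sub>1 \<otimes>\<^bsub>ZmodX n\<^esub> f\<^sub>1 \<and>
        is_gcmd n (X_pow n (n\<^sup>2) \<ominus>\<^bsub>ZmodX n\<^esub> X_pow n 1) f\<^sub>1 F\<^sub>2 \<and>
        f\<^sub>2 \<in> carrier (ZmodX n) \<and> f\<^sub>1 = F\<^sub>2 \<otimes>\<^bsub>ZmodX n\<^esub> f\<^sub>2 \<and>
        f\<^sub>2 = \<one>\<^bsub>ZmodX n\<^esub> \<and>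
        F\<^sub>2 divides\<^bsub>ZmodX n\<^esub> subst_X_pow n F\<^sub>2 n \<and>
        even (deg (Zmod n) F\<^sub>2) \<and>
        (-1) ^ (deg (Zmod n) F\<^sub>2 div 2) = jacobi (quadratic_discr f) n)"

text \<open>All conditions depend only on \<open>f\<close> modulo \<open>n\<close>, so liars in \<open>(\<int>/n\<int>)[x]\<close> are counted as the
  reductions of integral ones. Taking the discriminant of an integral lift matters for even \<open>n\<close>
  only: there \<open>jacobi \<Delta> n\<close> is determined by \<open>f\<close> modulo \<open>n\<close> (when \<open>f(0) \<Delta>\<close> is odd,
  \<open>\<Delta> mod 8 = 5\<close>), but not by \<open>\<Delta>\<close> modulo \<open>n\<close>.\<close>

definition L2_plus :: "nat \<Rightarrow> nat" where
  "L2_plus n = card (reduce_poly n `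
     {f. frobenius_pseudoprime2 n f \<and> jacobi (quadratic_discr f) n = 1})"

end

theory Submission
  imports Defs
begin

text \<open>
  If the Jacobi symbol is \<open>+1\<close>, then \<open>deg F\<^sub>2 = 0\<close>, so \<open>f = x\<^sup>2 + b x + c\<close> is a liar iff it divides
  \<open>x ^ n - x\<close>, equivalently (as \<open>c\<close> is a unit) \<open>x ^ (n - 1) - 1\<close>, modulo \<open>n\<close>. Counting the pairs
  \<open>(b, c)\<close> with weight \<open>(1 + (\<Delta>/n)) / 2\<close> gives two sums that factor over the prime powers
  \<open>p ^ r\<close> dividing \<open>n\<close>. Since \<open>p\<close> does not divide \<open>n - 1\<close>, Hensel lifting reduces each factor to
  \<open>r = 1\<close>. For odd \<open>p\<close>, quadratics whose discriminant is \<open>4 d\<close> times a nonzero square are parametrised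
  two-to-one by their roots \<open>a \<plusminus> y \<surd>d\<close> in \<open>\<int>/p[\<surd>d]\<close>, so it remains to count elements of order
  dividing \<open>n - 1\<close>: there are \<open>g\<^sup>2\<close> of them for \<open>d = 1\<close>, \<open>h\<close> for a nonresidue \<open>d\<close>, and \<open>g\<close> with \<open>y = 0\<close>.
\<close>

section \<open>Powers of the variable modulo a quadratic\<close>

text \<open>Roots cannot be lifted one at a time: an irreducible quadratic has no root in Z/p to
  start from. Therefore the quadratic factor itself is lifted, a pair \<open>(b, c)\<close> modulo
  \<open>p ^ r\<close> having exactly one lift modulo \<open>p ^ (r + 1)\<close>. The symbol of the
  discriminant at \<open>p\<close> depends only on \<open>(b, c)\<close> modulo \<open>p\<close>, so
  it is carried along, and the exponent \<open>r\<close> enters the final count only through the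
  sign \<open>(-1) ^ r\<close>. Polynomials stay over the integers and conditions become
  congruences, because \<open>p\<close>, \<open>p ^ r\<close> and \<open>n\<close> all have to be
  compared with one another. Elements with \<open>y = 0\<close> belong to no quadratic of nonzero
  discriminant; removing these \<open>g\<close> elements and halving gives
  \<open>A = (g^2 - g) / 2\<close> from \<open>d = 1\<close> and \<open>B = (h - g) / 2\<close> from
  a nonresidue. Even \<open>n\<close> fits the same formula: at \<open>p = 2\<close> one has
  \<open>g = 1\<close>, hence \<open>A = 0\<close>, while \<open>h = gcd(n - 1, 3)\<close> makes
  \<open>B\<close> equal to 1 or 0 according to whether \<open>x^2 + x + 1\<close> divides
  \<open>x ^ (n - 1) - 1\<close> modulo 2.\<close>

text \<open>\<open>x ^ m \<equiv> xlin b c m * x + xconst b c m\<close> modulo \<open>x\<^sup>2 + b x + c\<close>.\<close>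

primrec xpow :: "int \<Rightarrow> int \<Rightarrow> nat \<Rightarrow> int \<times> int" where
  "xpow b c 0 = (0, 1)"
| "xpow b c (Suc m) = (snd (xpow b c m) - b * fst (xpow b c m), - c * fst (xpow b c m))"

abbreviation xlin :: "int \<Rightarrow> int \<Rightarrow> nat \<Rightarrow> int" where "xlin b c m \<equiv> fst (xpow b c m)"
abbreviation xconst :: "int \<Rightarrow> int \<Rightarrow> nat \<Rightarrow> int" where "xconst b c m \<equiv> snd (xpow b c m)"

lemma X_power_minus_xpow_dvd: "[:c, b, 1:] dvd [:0, 1:] ^ m - [:xconst b c m, xlin b c m:]"
proof (induction m)
  case (Suc m)
  have "[:0, 1:] ^ Suc m - [:xconst b c (Suc m), xlin b c (Suc m):] =
     [:0, 1:] * ([:0, 1:] ^ m - [:xconst b c m, xlin b c m:]) + [:c, b, 1:] * [:xlin b c m:]"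
    by (simp add: algebra_simps)
  then show ?case using Suc by (metis dvd_add dvd_mult dvd_triv_left)
qed (simp add: one_pCons)

lemma xpow_cong:
  assumes "[b = b'] (mod m)" "[c = c'] (mod m)"
  shows "[xlin b c k = xlin b' c' k] (mod m) \<and> [xconst b c k = xconst b' c' k] (mod m)"
proof (induction k)
  case (Suc k)
  then show ?case
    using assms by (auto intro!: cong_diff cong_mult simp: cong_minus_minus_iff)
qed auto

text \<open>Divisibility in (Z/m)[x], phrased over the integers so that different moduli can be
  compared without maps between quotient rings.\<close>

definition dvd_mod :: "int \<Rightarrow> int poly \<Rightarrow> int poly \<Rightarrow> bool" where
  "dvd_mod m f g \<longleftrightarrow> (\<exists>q s. g = f * q + smult m s)"

text \<open>Dividing by a monic polynomial never divides coefficients; Horner's scheme rewrites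
  \<open>x * (u * x + v)\<close> once per coefficient of \<open>s\<close>.\<close>

lemma quadratic_remainder:
  fixes s :: "int poly"
  obtains q v u where "s = [:c, b, 1:] * q + [:v, u:]"
proof -
  have "\<exists>q v u. s = [:c, b, 1:] * q + [:v, u:]"
  proof (induction s)
    case 0
    show ?case by (rule exI[of _ 0], rule exI[of _ 0], rule exI[of _ 0]) simp
  next
    case (pCons a s)
    then obtain q v u where "s = [:c, b, 1:] * q + [:v, u:]" by blast
    then have "pCons a s = [:c, b, 1:] * (pCons u q) + [:a - c * u, v - b * u:]"
      by (simp add: algebra_simps)
    then show ?case by blast
  qed
  then show thesis using that by blast
qed

lemma quadratic_dvd_linear_imp_zero:
  fixes u v :: int
  assumes "[:c, b, 1:] * q = [:v, u:]"
  shows "q = 0"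
proof (rule ccontr)
  assume "q \<noteq> 0"
  then have "Polynomial.degree ([:c, b, 1:] * q) = 2 + Polynomial.degree q"
    by (subst degree_mult_eq) auto
  moreover have "Polynomial.degree [:v, u:] \<le> 1" by simp
  ultimately show False using assms by simp
qed

text \<open>Remainders are unique over Z/m as well: once the multiple of \<open>m\<close> is itself
  reduced, a linear multiple of the monic quadratic is left, which is zero by degree.\<close>

lemma dvd_mod_linear_iff: "dvd_mod m [:c, b, 1:] [:v, u:] \<longleftrightarrow> m dvd u \<and> m dvd v"
proof
  assume "dvd_mod m [:c, b, 1:] [:v, u:]"
  then obtain q s where qs: "[:v, u:] = [:c, b, 1:] * q + smult m s"
    by (auto simp: dvd_mod_def)
  obtain q' v' u' where s: "s = [:c, b, 1:] * q' + [:v', u':]"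
    by (rule quadratic_remainder)
  have "[:c, b, 1:] * (q + smult m q') = [:v - m * v', u - m * u':]"
  proof -
    define F where "F = [:c, b, 1:]"
    have "[:v, u:] = F * q + smult m (F * q' + [:v', u':])"
      using qs unfolding s F_def .
    then have "F * (q + smult m q') = [:v, u:] - smult m [:v', u':]"
      by (simp add: smult_add_right algebra_simps)
    then show ?thesis by (simp add: F_def)
  qed
  moreover from quadratic_dvd_linear_imp_zero[OF this] have "q + smult m q' = 0" .
  ultimately have "[:v - m * v', u - m * u':] = 0" by (metis mult_zero_right)
  then show "m dvd u \<and> m dvd v" by simp
next
  assume "m dvd u \<and> m dvd v"
  then obtain u' v' where "u = m * u'" "v = m * v'" by (auto elim!: dvdE)
  then have "[:v, u:] = [:c, b, 1:] * 0 + smult m [:v', u':]" by simp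
  then show "dvd_mod m [:c, b, 1:] [:v, u:]" unfolding dvd_mod_def by blast
qed

lemma dvd_mod_add: "dvd_mod m f g \<Longrightarrow> dvd_mod m f h \<Longrightarrow> dvd_mod m f (g + h)"
proof -
  assume "dvd_mod m f g" "dvd_mod m f h"
  then obtain q s q' s' where "g = f * q + smult m s" "h = f * q' + smult m s'"
    by (auto simp: dvd_mod_def)
  then have "g + h = f * (q + q') + smult m (s + s')"
    by (simp add: algebra_simps smult_add_right)
  then show ?thesis unfolding dvd_mod_def by blast
qed

lemma dvd_mod_mult: "dvd_mod m f g \<Longrightarrow> dvd_mod m f (h * g)"
proof -
  assume "dvd_mod m f g"
  then obtain q s where "g = f * q + smult m s" by (auto simp: dvd_mod_def)
  then have "h * g = f * (h * q) + smult m (h * s)" by (simp add: algebra_simps)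
  then show ?thesis unfolding dvd_mod_def by blast
qed

lemma dvd_mod_minus: "dvd_mod m f g \<Longrightarrow> dvd_mod m f (- g)"
  using dvd_mod_mult[of m f g "-1"] by simp

lemma dvd_mod_diff: "dvd_mod m f g \<Longrightarrow> dvd_mod m f h \<Longrightarrow> dvd_mod m f (g - h)"
  using dvd_mod_add[OF _ dvd_mod_minus] by fastforce

lemma dvd_imp_dvd_mod: "f dvd g \<Longrightarrow> dvd_mod m f g"
  unfolding dvd_mod_def by (metis add.right_neutral dvdE smult_0_right)

lemma dvd_mod_smult: "dvd_mod m f (smult m g)"
  unfolding dvd_mod_def by (metis add_0 mult_zero_right)

lemma dvd_mod_diff_cong: "dvd_mod m f (g - h) \<Longrightarrow> dvd_mod m f g \<longleftrightarrow> dvd_mod m f h"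
  using dvd_mod_diff[of m f g "g - h"] dvd_mod_add[of m f "g - h" h] by auto

text \<open>Divisibility becomes two integer congruences on the coordinates of \<open>x ^ N\<close>.
  The cases used are \<open>w = 1, z = 0\<close> for \<open>x ^ N - 1\<close> and
  \<open>w = 0, z = 1\<close> for \<open>x ^ N - x\<close>.\<close>

lemma dvd_mod_X_power_iff:
  "dvd_mod m [:c, b, 1:] ([:0, 1:] ^ N - [:w, z:]) \<longleftrightarrow> m dvd xlin b c N - z \<and> m dvd xconst b c N - w"
proof -
  have "[:c, b, 1:] dvd ([:0, 1:] ^ N - [:w, z:]) - [:xconst b c N - w, xlin b c N - z:]"
    using X_power_minus_xpow_dvd[of c b N] by (simp add: diff_diff_eq)
  from dvd_mod_diff_cong[OF dvd_imp_dvd_mod[OF this]] show ?thesis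
    by (simp add: dvd_mod_linear_iff)
qed

section \<open>Lifting from \<open>p ^ r\<close> to \<open>p ^ (r + 1)\<close>\<close>

text \<open>The equation \<open>x ^ N = 1\<close> in (Z/m)[x] modulo \<open>x^2 + b x + c\<close>,
  in coordinates.\<close>

definition unity :: "nat \<Rightarrow> int \<Rightarrow> int \<Rightarrow> int \<Rightarrow> bool" where
  "unity N m b c \<longleftrightarrow> m dvd xlin b c N \<and> m dvd xconst b c N - 1"

lemma unity_iff_dvd_mod: "unity N m b c \<longleftrightarrow> dvd_mod m [:c, b, 1:] ([:0, 1:] ^ N - 1)"
  using dvd_mod_X_power_iff[of m c b N 1 0] by (simp add: unity_def one_pCons)

lemma unity_cong:
  assumes "[b = b'] (mod m)" "[c = c'] (mod m)"
  shows "unity N m b c \<longleftrightarrow> unity N m b' c'"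
proof -
  have "m dvd xlin b c N \<longleftrightarrow> m dvd xlin b' c' N"
    using xpow_cong[OF assms] by (meson cong_dvd_iff)
  moreover have "[xconst b c N - 1 = xconst b' c' N - 1] (mod m)"
    using xpow_cong[OF assms] by (intro cong_diff) auto
  then have "m dvd xconst b c N - 1 \<longleftrightarrow> m dvd xconst b' c' N - 1" by (meson cong_dvd_iff)
  ultimately show ?thesis by (simp add: unity_def)
qed

text \<open>With \<open>f = x\<^sup>2 + b x + c\<close> and \<open>x ^ N - 1 = f q + p ^ r s\<close>, the perturbation \<open>f + p ^ r a\<close>
  divides \<open>x ^ N - 1\<close> modulo \<open>p ^ (r + 1)\<close> iff \<open>s \<equiv> a q\<close> modulo \<open>(f, p)\<close>; differentiating gives
  \<open>N \<equiv> x f' q\<close>, so that \<open>q\<close> is invertible.\<close>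

lemma unity_lift_iff:
  fixes p :: int
  assumes p: "p \<noteq> 0" and r: "r \<ge> 1"
    and qs: "[:0, 1:] ^ N - 1 = [:c, b, 1:] * q + smult (p ^ r) s"
  shows "unity N (p ^ Suc r) (b + p ^ r * u) (c + p ^ r * v) \<longleftrightarrow>
    dvd_mod p [:c, b, 1:] (s - [:v, u:] * q)"
proof -
  define a where "a = [:v, u:]"
  define f where "f = [:c, b, 1:]"
  define f' where "f' = f + smult (p ^ r) a"
  have f': "f' = [:c + p ^ r * v, b + p ^ r * u, 1:]" by (simp add: f'_def f_def a_def)
  have "f' \<noteq> 0" unfolding f' by simp
  have eq: "[:0, 1:] ^ N - 1 = f' * q + smult (p ^ r) (s - a * q)"
    using qs by (simp add: f'_def f_def algebra_simps smult_diff_right)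
  \<comment> \<open>As \<open>r \<ge> 1\<close>, the polynomials \<open>f\<close> and
    \<open>f'\<close> agree modulo \<open>p\<close>, and \<open>p ^ (2 * r)\<close> is a multiple of
    \<open>p ^ Suc r\<close>.\<close>
  obtain k where k: "r = Suc k" using r by (cases r) auto
  have "dvd_mod (p ^ Suc r) f' ([:0, 1:] ^ N - 1) \<longleftrightarrow> dvd_mod p f (s - a * q)"
  proof
    assume "dvd_mod p f (s - a * q)"
    then obtain w z where "s - a * q = f * w + smult p z" by (auto simp: dvd_mod_def)
    then have "[:0, 1:] ^ N - 1 =
        f' * (q + smult (p ^ r) w) + smult (p ^ Suc r) (z - smult (p ^ k) (a * w))"
      by (simp add: eq f'_def k algebra_simps smult_add_right smult_diff_right)
    then show "dvd_mod (p ^ Suc r) f' ([:0, 1:] ^ N - 1)" unfolding dvd_mod_def by blast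
  next
    assume "dvd_mod (p ^ Suc r) f' ([:0, 1:] ^ N - 1)"
    then obtain q' s' where "[:0, 1:] ^ N - 1 = f' * q' + smult (p ^ Suc r) s'"
      by (auto simp: dvd_mod_def)
    then have e: "f' * (q' - q) = smult (p ^ r) (s - a * q - smult p s')"
      by (simp add: eq algebra_simps smult_diff_right smult_add_right)
    \<comment> \<open>Since \<open>f'\<close> is monic, \<open>p ^ r\<close> can be cancelled in
      \<open>e\<close>: dividing by \<open>f'\<close> leaves \<open>p ^ r\<close> times a linear
      remainder, which vanishes by degree.\<close>
    obtain w y z where t: "s - a * q - smult p s' = f' * w + [:y, z:]"
      unfolding f' by (rule quadratic_remainder)
    have "f' * (q' - q - smult (p ^ r) w) = [:p ^ r * y, p ^ r * z:]"
      using e t by (simp add: algebra_simps smult_add_right)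
    then have "q' - q = smult (p ^ r) w"
      using quadratic_dvd_linear_imp_zero unfolding f' by (metis eq_iff_diff_eq_0)
    with e have "smult (p ^ r) (f' * w) = smult (p ^ r) (s - a * q - smult p s')" by simp
    then have "smult (p ^ r) (f' * w - (s - a * q - smult p s')) = 0"
      by (simp only: smult_diff_right diff_self)
    then have "f' * w = s - a * q - smult p s'"
      using p by simp
    then have "s - a * q = f * w + smult p (s' + smult (p ^ k) (a * w))"
      by (simp add: f'_def k algebra_simps smult_add_right)
    then show "dvd_mod p f (s - a * q)" unfolding dvd_mod_def by blast
  qed
  then show ?thesis by (simp add: unity_iff_dvd_mod f' f_def a_def)
qed


text \<open>Multiplying the derivative by \<open>x\<close> restores \<open>x ^ N\<close>, which is
  again replaced by \<open>f q + 1\<close>, so no exponent \<open>N - 1\<close> appears. The factor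
  \<open>k\<close> stands for the rest of the prime power,
  \<open>p ^ r = p * p ^ (r - 1)\<close>.\<close>

lemma unity_imp_dvd_mod_deriv:
  assumes qs: "[:0, 1:] ^ N - 1 = f * q + smult (m * k) s"
  shows "dvd_mod m f (of_nat N - [:0, 1:] * pderiv f * q)"
proof -
  define X where "X = ([:0, 1:] :: int poly)"
  have "pderiv (X ^ N - 1) = pderiv (f * q + smult (m * k) s)"
    using qs by (simp add: X_def)
  then have "X * pderiv (X ^ N) = X * (f * pderiv q + q * pderiv f + smult (m * k) (pderiv s))"
    by (simp add: pderiv_diff pderiv_add pderiv_mult pderiv_smult)
  moreover have "X * pderiv (X ^ N) = of_nat N * X ^ N"
  proof (cases N)
    case (Suc k)
    have "pderiv X = 1" by (simp add: X_def pderiv_pCons)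
    then show ?thesis
      by (simp only: Suc pderiv_power_Suc)
        (simp add: of_nat_poly algebra_simps smult_add_left)
  qed simp
  moreover have "of_nat N * X ^ N = of_nat N * (f * q + smult (m * k) s + 1)"
    using qs by (simp add: X_def flip: qs)
  ultimately have "of_nat N - X * pderiv f * q = f * (X * pderiv q - of_nat N * q) +
      smult m (smult k (X * pderiv s - of_nat N * s))"
    by (simp add: algebra_simps smult_add_right smult_diff_right)
  then show ?thesis unfolding dvd_mod_def X_def by blast
qed

text \<open>Hensel's lemma for a quadratic factor: the correction \<open>a\<close> must solve
  \<open>s = a q\<close> modulo \<open>(f, p)\<close>, and \<open>q\<close> is a unit there because
  \<open>x f' q = N\<close> is prime to \<open>p\<close>.\<close>

lemma unity_lift_unique:
  fixes p :: nat
  assumes p: "prime p" "\<not> p dvd N" and r: "r \<ge> 1" and unity: "unity N (int p ^ r) b c"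
  obtains u v where
    "\<And>u' v'. unity N (int p ^ Suc r) (b + int p ^ r * u') (c + int p ^ r * v') \<longleftrightarrow>
       [u' = u] (mod int p) \<and> [v' = v] (mod int p)"
proof -
  define f where "f = [:c, b, 1:]"
  obtain q s where qs: "[:0, 1:] ^ N - 1 = f * q + smult (int p ^ r) s"
    using unity by (auto simp: unity_iff_dvd_mod dvd_mod_def f_def)
  obtain k where k: "r = Suc k" using r by (cases r) auto
  have "coprime (int N) (int p)"
    using p by (metis coprime_commute coprime_int_iff prime_imp_coprime)
  then obtain M where M: "[int N * M = 1] (mod int p)"
    using cong_solve_coprime_int by blast
  \<comment> \<open>\<open>T\<close> inverts \<open>q\<close> modulo \<open>(f, p)\<close>, by
    \<open>x f' q = N\<close> and the choice of \<open>M\<close> as inverse of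
    \<open>N\<close>.\<close>
  define T where "T = smult M ([:0, 1:] * pderiv f)"
  have "dvd_mod (int p) f (of_nat N - [:0, 1:] * pderiv f * q)"
    by (rule unity_imp_dvd_mod_deriv[of N f q _ "int p ^ k" s]) (use qs k in simp)
  then have "dvd_mod (int p) f ([:M:] * (of_nat N - [:0, 1:] * pderiv f * q))"
    by (rule dvd_mod_mult)
  then have 1: "dvd_mod (int p) f (smult M (of_nat N) - T * q)"
    by (simp add: T_def algebra_simps smult_diff_right)
  obtain l where "int N * M - 1 = int p * l"
    using M by (auto simp: cong_iff_dvd_diff elim!: dvdE)
  then have "1 = smult M (of_nat N) - smult (int p) [:l:]"
    by (simp add: of_nat_poly one_pCons algebra_simps)
  then have "1 - T * q = (smult M (of_nat N) - smult (int p) [:l:]) - T * q"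
    by (rule arg_cong)
  also have "\<dots> = (smult M (of_nat N) - T * q) - smult (int p) [:l:]"
    by (simp only: diff_diff_eq add.commute)
  finally have "1 - T * q = (smult M (of_nat N) - T * q) - smult (int p) [:l:]" .
  then have inv: "dvd_mod (int p) f (1 - T * q)"
    using 1 dvd_mod_diff dvd_mod_smult by metis
  \<comment> \<open>The remainder of \<open>T s\<close>, that is of \<open>s / q\<close>, holds the
    coefficients of the only possible correction.\<close>
  obtain w v u where w: "T * s = f * w + [:v, u:]"
    unfolding f_def by (rule quadratic_remainder)
  have "unity N (int p ^ Suc r) (b + int p ^ r * u') (c + int p ^ r * v') \<longleftrightarrow>
       [u' = u] (mod int p) \<and> [v' = v] (mod int p)" for u' v'
  proof -
    define a where "a = [:v', u':]"
    have "[:v - v', u - u':] = [:v, u:] - a" by (simp add: a_def)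
    moreover have "T * (s - a * q) - ([:v, u:] - a) = f * w + a * (1 - T * q)"
      using w by (simp add: algebra_simps)
    moreover have "dvd_mod (int p) f (f * w + a * (1 - T * q))"
      by (rule dvd_mod_add[OF dvd_imp_dvd_mod[OF dvd_triv_left] dvd_mod_mult[OF inv]])
    ultimately have 2: "dvd_mod (int p) f (T * (s - a * q)) \<longleftrightarrow> dvd_mod (int p) f [:v - v', u - u':]"
      by (metis dvd_mod_diff_cong)
    \<comment> \<open>Multiplying by \<open>T\<close> loses nothing, as multiplying by
      \<open>q\<close> undoes it modulo \<open>(f, p)\<close>.\<close>
    have "dvd_mod (int p) f ((s - a * q) * (1 - T * q))"
      using inv by (rule dvd_mod_mult)
    moreover have "(s - a * q) * (1 - T * q) = (s - a * q) - q * (T * (s - a * q))"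
      by (simp add: algebra_simps)
    ultimately have "dvd_mod (int p) f (s - a * q) \<longleftrightarrow> dvd_mod (int p) f (q * (T * (s - a * q)))"
      using dvd_mod_diff_cong by metis
    then have "dvd_mod (int p) f (s - a * q) \<longleftrightarrow> dvd_mod (int p) f (T * (s - a * q))"
      using dvd_mod_mult by blast
    then have "dvd_mod (int p) f (s - a * q) \<longleftrightarrow> [u' = u] (mod int p) \<and> [v' = v] (mod int p)"
      unfolding 2 by (auto simp: f_def dvd_mod_linear_iff cong_iff_dvd_diff dvd_diff_commute)
    then show ?thesis
      using unity_lift_iff[OF _ r qs[unfolded f_def], of u' v'] p
      by (auto simp: f_def a_def prime_gt_0_nat)
  qed
  then show thesis by (rule that)
qed

definition unity_pairs :: "nat \<Rightarrow> int \<Rightarrow> (int \<times> int) set" where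
  "unity_pairs N m = {(b, c) \<in> {0..<m} \<times> {0..<m}. unity N m b c}"

text \<open>Existence of a lift gives surjectivity and its uniqueness injectivity; the correction,
  known modulo \<open>p\<close>, is one base-\<open>p\<close> digit in each coordinate.\<close>

lemma bij_betw_unity_pairs_lift:
  fixes p :: nat
  assumes p: "prime p" "\<not> p dvd N" and r: "r \<ge> 1"
  shows "bij_betw (map_prod (\<lambda>b. b mod int p ^ r) (\<lambda>c. c mod int p ^ r))
    (unity_pairs N (int p ^ Suc r)) (unity_pairs N (int p ^ r))"
proof -
  define m where "m = int p ^ r"
  have m: "m > 0" using p by (simp add: m_def prime_gt_0_nat)
  have p0: "int p > 0" using p by (simp add: prime_gt_0_nat)
  have lift: "b \<in> {0..<m} \<Longrightarrow> u \<in> {0..<int p} \<Longrightarrow> b + m * u \<in> {0..<int p ^ Suc r}" for b u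
  proof -
    assume "b \<in> {0..<m}" "u \<in> {0..<int p}"
    then have "m * u \<le> m * (int p - 1)" "b < m" "0 \<le> b" "0 \<le> m * u"
      using m by (auto intro: mult_left_mono)
    then show ?thesis by (simp add: m_def algebra_simps)
  qed
  have quot: "b div m \<in> {0..<int p}" if "b \<in> {0..<int p ^ Suc r}" for b
  proof -
    have "m * (b div m) \<le> b" using m by (simp add: minus_mod_eq_mult_div [symmetric])
    also have "b < m * int p" using that by (simp add: m_def mult.commute)
    finally have "b div m < int p" using m by simp
    then show ?thesis using that m by (simp add: pos_imp_zdiv_nonneg_iff)
  qed
  have unity_down: "unity N m b c" if "unity N (int p ^ Suc r) b c" for b c
    using that by (auto simp: unity_def m_def intro: dvd_mult_right)
  show ?thesis unfolding m_def[symmetric]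
  proof (rule bij_betwI')
    fix x y assume "x \<in> unity_pairs N (int p ^ Suc r)" "y \<in> unity_pairs N (int p ^ Suc r)"
    moreover obtain b c where x: "x = (b, c)" by (cases x)
    moreover obtain b' c' where y: "y = (b', c')" by (cases y)
    ultimately have xy: "b \<in> {0..<int p ^ Suc r}" "c \<in> {0..<int p ^ Suc r}"
      "b' \<in> {0..<int p ^ Suc r}" "c' \<in> {0..<int p ^ Suc r}"
      "unity N (int p ^ Suc r) b c" "unity N (int p ^ Suc r) b' c'"
      by (auto simp: unity_pairs_def simp del: power_Suc)
    show "map_prod (\<lambda>b. b mod m) (\<lambda>c. c mod m) x = map_prod (\<lambda>b. b mod m) (\<lambda>c. c mod m) y
        \<longleftrightarrow> x = y"
    proof
      assume "map_prod (\<lambda>b. b mod m) (\<lambda>c. c mod m) x = map_prod (\<lambda>b. b mod m) (\<lambda>c. c mod m) y"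
      then have eq: "b mod m = b' mod m" "c mod m = c' mod m" by (auto simp: x y)
      have "unity N (int p ^ r) (b mod m) (c mod m)"
        using unity_down[OF xy(5)] unity_cong[of "b mod m" b m "c mod m" c N]
        by (simp add: m_def)
      from unity_lift_unique[OF p r this] obtain u v where
        uv: "\<And>u' v'. unity N (int p ^ Suc r) (b mod m + m * u') (c mod m + m * v') \<longleftrightarrow>
          [u' = u] (mod int p) \<and> [v' = v] (mod int p)"
        unfolding m_def by blast
      \<comment> \<open>The quotients by \<open>m\<close> are the top base-\<open>p\<close> digits.
        Being determined modulo \<open>p\<close> and lying in \<open>{0..<p}\<close>, they are
        determined exactly.\<close>
      have "[b div m = u] (mod int p)" "[c div m = v] (mod int p)"
        using uv[of "b div m" "c div m"] xy(5) by auto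
      moreover have "[b' div m = u] (mod int p)" "[c' div m = v] (mod int p)"
        using uv[of "b' div m" "c' div m"] xy(6) by (auto simp: eq)
      ultimately have "[b div m = b' div m] (mod int p)" "[c div m = c' div m] (mod int p)"
        by (meson cong_sym cong_trans)+
      then have "b div m = b' div m" "c div m = c' div m"
        using quot xy by (auto simp: cong_def)
      then show "x = y" using eq by (metis x y mult_div_mod_eq)
    qed simp
  next
    fix x assume "x \<in> unity_pairs N (int p ^ Suc r)"
    then show "map_prod (\<lambda>b. b mod m) (\<lambda>c. c mod m) x \<in> unity_pairs N m"
      using m unity_down unity_cong[of "fst x mod m" "fst x" m "snd x mod m" "snd x" N]
      by (auto simp: unity_pairs_def simp del: power_Suc)
  next
    fix y assume "y \<in> unity_pairs N m"
    moreover obtain b c where y: "y = (b, c)" by (cases y)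
    ultimately have bc: "b \<in> {0..<m}" "c \<in> {0..<m}" "unity N m b c" by (auto simp: unity_pairs_def)
    from unity_lift_unique[OF p r bc(3)[unfolded m_def]] obtain u v where
      uv: "\<And>u' v'. unity N (int p ^ Suc r) (b + m * u') (c + m * v') \<longleftrightarrow>
        [u' = u] (mod int p) \<and> [v' = v] (mod int p)"
      unfolding m_def by blast
    let ?x = "(b + m * (u mod int p), c + m * (v mod int p))"
    have "u mod int p \<in> {0..<int p}" "v mod int p \<in> {0..<int p}" using p0 by auto
    then have "?x \<in> unity_pairs N (int p ^ Suc r)"
      using lift[OF bc(1)] lift[OF bc(2)] uv by (auto simp: unity_pairs_def simp del: power_Suc)
    moreover have "y = map_prod (\<lambda>b. b mod m) (\<lambda>c. c mod m) ?x"
      using bc y by simp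
    ultimately show "\<exists>x\<in>unity_pairs N (int p ^ Suc r). y = map_prod (\<lambda>b. b mod m) (\<lambda>c. c mod m) x"
      by blast
  qed
qed

text \<open>The bijections of the lifting step preserve residues modulo \<open>p\<close>, on which
  alone the summand depends.\<close>

lemma sum_unity_pairs_prime_power:
  fixes p :: nat and F :: "int \<Rightarrow> int \<Rightarrow> 'a::comm_monoid_add"
  assumes p: "prime p" "\<not> p dvd N" and r: "r \<ge> 1"
  shows "(\<Sum>(b, c)\<in>unity_pairs N (int p ^ r). F (b mod int p) (c mod int p)) = (\<Sum>(b, c)\<in>unity_pairs N (int p). F b c)"
  using r
proof (induction r rule: dec_induct)
  case base
  show ?case by (rule sum.cong) (auto simp: unity_pairs_def)
next
  case (step r)
  have "int p dvd int p ^ r" using step by (intro dvd_power) auto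
  then have "(\<Sum>(b, c)\<in>unity_pairs N (int p ^ r). F (b mod int p) (c mod int p)) =
      (\<Sum>(b, c)\<in>unity_pairs N (int p ^ Suc r). F (b mod int p) (c mod int p))"
    by (subst sum.reindex_bij_betw[OF bij_betw_unity_pairs_lift[OF p step(1)], symmetric])
      (simp add: case_prod_unfold mod_mod_cancel)
  then show ?case using step by simp
qed

section \<open>Products over coprime moduli\<close>

text \<open>Chinese remaindering in \<open>b\<close> and \<open>c\<close> at once: the double sum
  becomes a fourfold one over independent residues and splits.\<close>

lemma sum_square_mult:
  fixes F G :: "int \<Rightarrow> int \<Rightarrow> 'a::comm_semiring_1"
  assumes "coprime m n" "m > 0" "n > 0"
    and F: "\<And>b c. F (b mod m) (c mod m) = F b c"
    and G: "\<And>b c. G (b mod n) (c mod n) = G b c"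
  shows "(\<Sum>b\<in>{0..<m * n}. \<Sum>c\<in>{0..<m * n}. F b c * G b c) =
    (\<Sum>b\<in>{0..<m}. \<Sum>c\<in>{0..<m}. F b c) * (\<Sum>b\<in>{0..<n}. \<Sum>c\<in>{0..<n}. G b c)"
proof -
  let ?h = "\<lambda>x. (x mod m, x mod n)"
  have inj: "inj_on ?h {0..<m * n}"
  proof (rule inj_onI)
    fix x y assume xy: "x \<in> {0..<m * n}" "y \<in> {0..<m * n}" "?h x = ?h y"
    then have "[x = y] (mod m)" "[x = y] (mod n)" by (auto simp: cong_def)
    then have "[x = y] (mod m * n)" using assms(1) by (rule coprime_cong_mult)
    then show "x = y" using xy by (simp add: cong_def)
  qed
  have "?h ` {0..<m * n} = {0..<m} \<times> {0..<n}"
  proof (rule card_subset_eq)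
    show "?h ` {0..<m * n} \<subseteq> {0..<m} \<times> {0..<n}" using assms by auto
    show "card (?h ` {0..<m * n}) = card ({0..<m} \<times> {0..<n})"
      using assms by (simp add: card_image[OF inj] nat_mult_distrib)
  qed simp
  with inj have bij: "bij_betw ?h {0..<m * n} ({0..<m} \<times> {0..<n})"
    by (simp add: bij_betw_def)
  have crt: "(\<Sum>x\<in>{0..<m * n}. H (x mod m) (x mod n)) = (\<Sum>y\<in>{0..<m}. \<Sum>z\<in>{0..<n}. H y z)"
    for H :: "int \<Rightarrow> int \<Rightarrow> 'a"
    using sum.reindex_bij_betw[OF bij, of "\<lambda>(y, z). H y z"] by (simp add: sum.cartesian_product)
  have "(\<Sum>b\<in>{0..<m * n}. \<Sum>c\<in>{0..<m * n}. F b c * G b c) =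
      (\<Sum>b\<in>{0..<m * n}. \<Sum>c\<in>{0..<m * n}. F (b mod m) (c mod m) * G (b mod n) (c mod n))"
    by (simp add: F G)
  also have "\<dots> = (\<Sum>y\<in>{0..<m}. \<Sum>z\<in>{0..<n}. \<Sum>y'\<in>{0..<m}. \<Sum>z'\<in>{0..<n}. F y y' * G z z')"
    by (simp add: crt[of "\<lambda>y' z'. F _ y' * G _ z'"] crt[of "\<lambda>y z. \<Sum>y'\<in>_. \<Sum>z'\<in>_. F y y' * G z z'"])
  also have "\<dots> = (\<Sum>y\<in>{0..<m}. \<Sum>y'\<in>{0..<m}. F y y') * (\<Sum>z\<in>{0..<n}. \<Sum>z'\<in>{0..<n}. G z z')"
    by (simp add: sum_product)
  finally show ?thesis .
qed

lemma sum_square_prod: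
  fixes F :: "nat \<Rightarrow> int \<Rightarrow> int \<Rightarrow> 'a::comm_semiring_1"
  assumes "\<And>i. i < k \<Longrightarrow> m i > 0"
    and "\<And>i j. i < k \<Longrightarrow> j < k \<Longrightarrow> i \<noteq> j \<Longrightarrow> coprime (m i) (m j)"
    and "\<And>i b c. i < k \<Longrightarrow> F i (b mod m i) (c mod m i) = F i b c"
  shows "(\<Sum>b\<in>{0..<\<Prod>i<k. m i}. \<Sum>c\<in>{0..<\<Prod>i<k. m i}. \<Prod>i<k. F i b c) =
    (\<Prod>i<k. \<Sum>b\<in>{0..<m i}. \<Sum>c\<in>{0..<m i}. F i b c)"
  using assms
proof (induction k)
  case (Suc k)
  have per: "(\<Prod>i<k. F i (b mod (\<Prod>i<k. m i)) (c mod (\<Prod>i<k. m i))) = (\<Prod>i<k. F i b c)" for b c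
  proof (rule prod.cong)
    fix i assume "i \<in> {..<k}"
    then have "m i dvd (\<Prod>i<k. m i)" by (intro dvd_prodI) auto
    then show "F i (b mod (\<Prod>i<k. m i)) (c mod (\<Prod>i<k. m i)) = F i b c"
      using Suc.prems(3)[of i] \<open>i \<in> {..<k}\<close> by (metis lessThan_iff less_SucI mod_mod_cancel)
  qed simp
  have "(\<Sum>b\<in>{0..<(\<Prod>i<k. m i) * m k}. \<Sum>c\<in>{0..<(\<Prod>i<k. m i) * m k}. (\<Prod>i<k. F i b c) * F k b c) =
    (\<Sum>b\<in>{0..<\<Prod>i<k. m i}. \<Sum>c\<in>{0..<\<Prod>i<k. m i}. \<Prod>i<k. F i b c) *
    (\<Sum>b\<in>{0..<m k}. \<Sum>c\<in>{0..<m k}. F k b c)"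
    by (rule sum_square_mult)
      (use Suc.prems per in \<open>auto intro!: prod_coprime_left prod_pos\<close>)
  then show ?case using Suc by simp
qed simp

section \<open>Counting modulo a prime\<close>

text \<open>\<open>spow d a y m\<close> is \<open>(a + y \<surd>d) ^ m\<close> in \<open>\<int>[\<surd>d]\<close>, the pair \<open>(u, v)\<close> standing for \<open>u + v \<surd>d\<close>.\<close>

primrec spow :: "int \<Rightarrow> int \<Rightarrow> int \<Rightarrow> nat \<Rightarrow> int \<times> int" where
  "spow d a y 0 = (1, 0)"
| "spow d a y (Suc m) =
    (fst (spow d a y m) * a + d * snd (spow d a y m) * y,
     fst (spow d a y m) * y + snd (spow d a y m) * a)"

definition spow_unity :: "int \<Rightarrow> nat \<Rightarrow> int \<Rightarrow> int \<Rightarrow> int \<Rightarrow> bool" where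
  "spow_unity d N p a y \<longleftrightarrow> [fst (spow d a y N) = 1] (mod p) \<and> [snd (spow d a y N) = 0] (mod p)"

text \<open>The element \<open>a + y sqrt d\<close> is a root of
  \<open>x^2 - 2 a x + (a^2 - d y^2)\<close>; it is substituted for \<open>x\<close> in
  \<open>xlin * x + xconst\<close>.\<close>

lemma spow_eq_xpow:
  "spow d a y m = (xlin (- 2 * a) (a\<^sup>2 - d * y\<^sup>2) m * a + xconst (- 2 * a) (a\<^sup>2 - d * y\<^sup>2) m,
     xlin (- 2 * a) (a\<^sup>2 - d * y\<^sup>2) m * y)"
  by (induction m) (auto simp: algebra_simps power2_eq_square)

text \<open>With \<open>y\<close> invertible, the coordinate \<open>xlin * y\<close> at
  \<open>sqrt d\<close> reveals \<open>xlin\<close>, so evaluation at the root loses no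
  information.\<close>

lemma spow_unity_iff_unity:
  assumes "coprime y p"
  shows "spow_unity d N p a y \<longleftrightarrow> unity N p (- 2 * a) (a\<^sup>2 - d * y\<^sup>2)"
proof -
  let ?u = "xlin (- 2 * a) (a\<^sup>2 - d * y\<^sup>2) N" and ?v = "xconst (- 2 * a) (a\<^sup>2 - d * y\<^sup>2) N"
  have "[?u * y = 0] (mod p) \<longleftrightarrow> p dvd ?u"
    using assms by (simp add: cong_0_iff coprime_dvd_mult_left_iff coprime_commute)
  moreover have "[?u * a + ?v = 1] (mod p) \<longleftrightarrow> p dvd ?v - 1" if "p dvd ?u"
    using that by (simp add: cong_iff_dvd_diff add_diff_eq[symmetric] dvd_add_right_iff)
  ultimately show ?thesis
    by (auto simp: spow_unity_def unity_def spow_eq_xpow)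
qed

lemma spow_0: "spow d a 0 m = (a ^ m, 0)"
  by (induction m) auto

lemma spow_1: "fst (spow 1 a y m) + snd (spow 1 a y m) = (a + y) ^ m \<and>
    fst (spow 1 a y m) - snd (spow 1 a y m) = (a - y) ^ m"
proof (induction m)
  case (Suc m)
  have "fst (spow 1 a y (Suc m)) + snd (spow 1 a y (Suc m)) =
      (fst (spow 1 a y m) + snd (spow 1 a y m)) * (a + y)"
    "fst (spow 1 a y (Suc m)) - snd (spow 1 a y (Suc m)) =
      (fst (spow 1 a y m) - snd (spow 1 a y m)) * (a - y)"
    by (simp_all add: algebra_simps)
  then show ?case by (simp only: Suc power_Suc2)
qed simp

text \<open>For \<open>d = 1\<close> the ring splits through \<open>sqrt 1 = 1\<close> and
  \<open>sqrt 1 = -1\<close>. The two images \<open>P + Q\<close> and \<open>P - Q\<close> determine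
  \<open>2 P\<close> and \<open>2 Q\<close>, hence \<open>P\<close> and \<open>Q\<close> for odd
  \<open>p\<close>.\<close>

lemma spow_unity_1_iff:
  assumes "odd p"
  shows "spow_unity 1 N p a y \<longleftrightarrow> [(a + y) ^ N = 1] (mod p) \<and> [(a - y) ^ N = 1] (mod p)"
proof -
  let ?P = "fst (spow 1 a y N)" and ?Q = "snd (spow 1 a y N)"
  have two: "p dvd 2 * z \<longleftrightarrow> p dvd z" for z
    using assms by (simp add: coprime_dvd_mult_right_iff)
  then have "p dvd ?P - 1 \<and> p dvd ?Q \<longleftrightarrow> p dvd 2 * (?P - 1) \<and> p dvd 2 * ?Q"
    by (simp only: two)
  also have "\<dots> \<longleftrightarrow> p dvd (?P + ?Q - 1) + (?P - ?Q - 1) \<and> p dvd (?P + ?Q - 1) - (?P - ?Q - 1)"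
    by (simp add: algebra_simps)
  also have "\<dots> \<longleftrightarrow> p dvd ?P + ?Q - 1 \<and> p dvd ?P - ?Q - 1"
  proof
    assume *: "p dvd (?P + ?Q - 1) + (?P - ?Q - 1) \<and> p dvd (?P + ?Q - 1) - (?P - ?Q - 1)"
    then have "p dvd 2 * (?P + ?Q - 1)" "p dvd 2 * (?P - ?Q - 1)"
      using dvd_add dvd_diff by (fastforce simp: algebra_simps)+
    then show "p dvd ?P + ?Q - 1 \<and> p dvd ?P - ?Q - 1"
      by (simp_all only: two)
  next
    assume "p dvd ?P + ?Q - 1 \<and> p dvd ?P - ?Q - 1"
    then show "p dvd (?P + ?Q - 1) + (?P - ?Q - 1) \<and> p dvd (?P + ?Q - 1) - (?P - ?Q - 1)"
      using dvd_add dvd_diff by blast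
  qed
  finally show ?thesis using spow_1[of a y N]
    by (auto simp: spow_unity_def cong_iff_dvd_diff)
qed

section \<open>Roots of unity in cyclic groups and finite fields\<close>

text \<open>For a generator \<open>a\<close> of a group of order \<open>M\<close>, the power
  \<open>a ^ i\<close> is a solution iff \<open>M\<close> divides \<open>i N\<close>, that is, iff
  \<open>M / gcd(N, M)\<close> divides \<open>i\<close>; there are \<open>gcd(N, M)\<close> such
  exponents below \<open>M\<close>.\<close>

lemma (in group) card_roots_of_unity:
  assumes fin: "finite (carrier G)" and a: "a \<in> carrier G"
    and gen: "carrier G = {a [^] i | i::nat. i \<in> UNIV}"
  shows "card {x \<in> carrier G. x [^] N = \<one>} = gcd N (Coset.order G)"
proof -
  define M where "M = Coset.order G"
  have M: "ord a = M"
    unfolding M_def Coset.order_def gen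
    using generate_pow_card[OF a] generate_pow_on_finite_carrier[OF fin a] by simp
  have M0: "M > 0" using fin order_gt_0_iff_finite M_def by blast
  define k where "k = gcd N M"
  have k0: "k > 0" using M0 by (simp add: k_def)
  have iff: "(a [^] i) [^] N = \<one> \<longleftrightarrow> M div k dvd i" for i :: nat
  proof -
    have "(a [^] i) [^] N = \<one> \<longleftrightarrow> M dvd i * N"
      using a by (simp add: nat_pow_pow pow_eq_id M)
    also have "\<dots> \<longleftrightarrow> (M div k) * k dvd (i * (N div k)) * k"
      by (simp add: k_def mult.assoc)
    also have "\<dots> \<longleftrightarrow> M div k dvd i * (N div k)"
      using k0 by simp
    also have "\<dots> \<longleftrightarrow> M div k dvd i"
      using M0 by (intro coprime_dvd_mult_left_iff)
        (auto simp: k_def coprime_commute gcd.commute intro: div_gcd_coprime)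
    finally show ?thesis .
  qed
  have inj: "inj_on (\<lambda>i::nat. a [^] i) {0..<M}"
    using ord_inj[OF a] M M0 by (auto simp: inj_on_def)
  have car: "carrier G = (\<lambda>i::nat. a [^] i) ` {0..<M}"
  proof -
    have "(\<lambda>i::nat. a [^] i) ` {0..<M} \<subseteq> carrier G" using a by auto
    moreover have "card ((\<lambda>i::nat. a [^] i) ` {0..<M}) = card (carrier G)"
      using card_image[OF inj] by (simp add: M_def Coset.order_def)
    ultimately show ?thesis using card_subset_eq[OF fin] by blast
  qed
  have "{x \<in> carrier G. x [^] N = \<one>} = (\<lambda>i::nat. a [^] i) ` {i \<in> {0..<M}. M div k dvd i}"
    unfolding car using iff by blast
  also have "card \<dots> = card {i \<in> {0..<M}. M div k dvd i}"
    by (rule card_image) (rule inj_on_subset[OF inj], auto)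
  also have "{i \<in> {0..<M}. M div k dvd i} = (\<lambda>j. (M div k) * j) ` {0..<k}"
  proof -
    have Mk: "M = (M div k) * k" by (simp add: k_def)
    have pos: "M div k > 0" using M0 Mk by (metis gr0I mult_0)
    show ?thesis
    proof (intro subset_antisym subsetI)
      fix i assume "i \<in> {i \<in> {0..<M}. M div k dvd i}"
      then obtain j where "i = (M div k) * j" "i < M" by (auto elim!: dvdE)
      moreover have "j < k" using calculation pos Mk by (metis mult_less_cancel1)
      ultimately show "i \<in> (\<lambda>j. (M div k) * j) ` {0..<k}" by auto
    next
      fix i assume "i \<in> (\<lambda>j. (M div k) * j) ` {0..<k}"
      then obtain j where "i = (M div k) * j" "j < k"
        by (metis (no_types, lifting) atLeastLessThan_iff imageE)
      moreover have "(M div k) * j < M" using pos Mk \<open>j < k\<close> by (metis mult_less_cancel1)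
      ultimately show "i \<in> {i \<in> {0..<M}. M div k dvd i}" by auto
    qed
  qed
  also have "card ((\<lambda>j. (M div k) * j) ` {0..<k}) = k"
  proof -
    have "M div k > 0" using M0 k0 by (simp add: k_def div_greater_zero_iff dvd_imp_le)
    then show ?thesis by (subst card_image) (auto simp: inj_on_def)
  qed
  finally show ?thesis by (simp add: k_def M_def)
qed

lemma (in field) card_roots_of_unity_field:
  assumes fin: "finite (carrier R)" and N: "N > (0::nat)"
  shows "card {x \<in> carrier R. x [^] N = \<one>} = gcd N (Coset.order R - 1)"
proof -
  obtain a where a: "a \<in> carrier (mult_of R)"
    and gen: "carrier (mult_of R) = {a [^] i | i::nat. i \<in> UNIV}"
    using finite_field_mult_group_has_gen[OF fin] by blast
  interpret G: group "mult_of R" by (rule field_mult_group)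
  have "card {x \<in> carrier (mult_of R). x [^]\<^bsub>mult_of R\<^esub> N = \<one>\<^bsub>mult_of R\<^esub>} = gcd N (Coset.order (mult_of R))"
    by (rule G.card_roots_of_unity[OF finite_mult_of[OF fin] a]) (use gen in \<open>simp only: nat_pow_mult_of\<close>)
  moreover have "{x \<in> carrier R. x [^] N = \<one>} =
      {x \<in> carrier (mult_of R). x [^]\<^bsub>mult_of R\<^esub> N = \<one>\<^bsub>mult_of R\<^esub>}"
    \<comment> \<open>Positivity of \<open>N\<close> excludes the zero element, which would count as
      a solution for \<open>N = 0\<close>.\<close>
    using N by (auto simp: nat_pow_mult_of nat_pow_zero)
  ultimately show ?thesis by (simp add: order_mult_of[OF fin])
qed

lemma card_roots_of_unity_mod_prime:
  fixes p :: nat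
  assumes p: "prime p" and N: "N > 0"
  shows "card {a \<in> {0..<int p}. [a ^ N = 1] (mod int p)} = gcd N (p - 1)"
proof -
  interpret R: residues_prime p "residue_ring (int p)" by unfold_locales (use p in auto)
  have pow: "x [^]\<^bsub>residue_ring (int p)\<^esub> N = x ^ N mod int p" if "x \<in> {0..<int p}" for x
    using R.pow_cong[of x N] that by simp
  have "1 mod int p = 1" using prime_gt_1_nat[OF p] by simp
  then have "{a \<in> {0..<int p}. [a ^ N = 1] (mod int p)} =
      {x \<in> carrier (residue_ring (int p)). x [^]\<^bsub>residue_ring (int p)\<^esub> N = \<one>\<^bsub>residue_ring (int p)\<^esub>}"
    using pow by (auto simp: R.res_carrier_eq R.res_one_eq cong_def)
  moreover have "Coset.order (residue_ring (int p)) = p"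
    by (simp add: Coset.order_def R.res_carrier_eq)
  ultimately show ?thesis
    using R.card_roots_of_unity_field[OF R.finite N] by simp
qed

section \<open>The ring obtained from Z/p by adjoining a square root of d\<close>

definition quad_ring :: "int \<Rightarrow> int \<Rightarrow> (int \<times> int) ring" where
  "quad_ring p d = \<lparr>carrier = {0..<p} \<times> {0..<p},
     monoid.mult = (\<lambda>(a, y) (a', y'). ((a * a' + d * y * y') mod p, (a * y' + y * a') mod p)),
     one = (1, 0), zero = (0, 0),
     add = (\<lambda>(a, y) (a', y'). ((a + a') mod p, (y + y') mod p))\<rparr>"

text \<open>Elements are presented as explicit residues so that products and sums can be computed on
  any representatives; each ring axiom then reduces to an integer identity.\<close>

lemma quad_ring_carrierE:
  assumes "x \<in> carrier (quad_ring p d)"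
  obtains a y where "x = (a mod p, y mod p)" "a \<in> {0..<p}" "y \<in> {0..<p}"
  using that[of "fst x" "snd x"] assms by (cases x) (simp add: quad_ring_def)

lemma quad_ring_carrierI: "p > 0 \<Longrightarrow> (a mod p, y mod p) \<in> carrier (quad_ring p d)"
  by (simp add: quad_ring_def)

lemma quad_ring_mult:
  "(a mod p, y mod p) \<otimes>\<^bsub>quad_ring p d\<^esub> (a' mod p, y' mod p) =
     ((a * a' + d * y * y') mod p, (a * y' + y * a') mod p)"
proof -
  have "[(a mod p) * (a' mod p) + d * (y mod p) * (y' mod p) = a * a' + d * y * y'] (mod p)"
    "[(a mod p) * (y' mod p) + (y mod p) * (a' mod p) = a * y' + y * a'] (mod p)"
    by (intro cong_add cong_mult; simp)+
  then show ?thesis by (simp add: quad_ring_def cong_def)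
qed

lemma quad_ring_add:
  "(a mod p, y mod p) \<oplus>\<^bsub>quad_ring p d\<^esub> (a' mod p, y' mod p) = ((a + a') mod p, (y + y') mod p)"
  by (simp add: quad_ring_def mod_simps)

lemma quad_ring_zero_one:
  assumes "p > 1"
  shows "\<zero>\<^bsub>quad_ring p d\<^esub> = (0 mod p, 0 mod p)" "\<one>\<^bsub>quad_ring p d\<^esub> = (1 mod p, 0 mod p)"
  using assms by (simp_all add: quad_ring_def)

lemma cring_quad_ring:
  assumes "p > 1"
  shows "cring (quad_ring p d)"
proof (rule cringI)
  note simps = quad_ring_mult quad_ring_add quad_ring_zero_one[OF assms]
  have closed: "(a mod p, y mod p) \<in> carrier (quad_ring p d)" for a y
    using assms by (simp add: quad_ring_carrierI)
  show "abelian_group (quad_ring p d)"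
  proof (rule abelian_groupI)
    fix x assume "x \<in> carrier (quad_ring p d)"
    then obtain a y where x: "x = (a mod p, y mod p)" by (rule quad_ring_carrierE)
    show "\<exists>y\<in>carrier (quad_ring p d). y \<oplus>\<^bsub>quad_ring p d\<^esub> x = \<zero>\<^bsub>quad_ring p d\<^esub>"
      by (rule bexI[OF _ closed[of "- a" "- y"]]) (simp only: x simps add.left_inverse)
  next
    fix x y
    assume "x \<in> carrier (quad_ring p d)" "y \<in> carrier (quad_ring p d)"
    then show "x \<oplus>\<^bsub>quad_ring p d\<^esub> y \<in> carrier (quad_ring p d)"
      by (elim quad_ring_carrierE) (simp only: simps closed)
  next
    fix x y z
    assume "x \<in> carrier (quad_ring p d)" "y \<in> carrier (quad_ring p d)" "z \<in> carrier (quad_ring p d)"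
    then show "x \<oplus>\<^bsub>quad_ring p d\<^esub> y \<oplus>\<^bsub>quad_ring p d\<^esub> z =
        x \<oplus>\<^bsub>quad_ring p d\<^esub> (y \<oplus>\<^bsub>quad_ring p d\<^esub> z)"
      by (elim quad_ring_carrierE) (simp only: simps, simp only: add.assoc)
  next
    fix x y
    assume "x \<in> carrier (quad_ring p d)" "y \<in> carrier (quad_ring p d)"
    then show "x \<oplus>\<^bsub>quad_ring p d\<^esub> y = y \<oplus>\<^bsub>quad_ring p d\<^esub> x"
      by (elim quad_ring_carrierE) (simp only: simps, simp only: add.commute)
  next
    fix x assume "x \<in> carrier (quad_ring p d)"
    then show "\<zero>\<^bsub>quad_ring p d\<^esub> \<oplus>\<^bsub>quad_ring p d\<^esub> x = x"
      by (elim quad_ring_carrierE) (simp only: simps, simp)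
  qed (simp only: simps closed)
  show "Group.comm_monoid (quad_ring p d)"
  proof (rule comm_monoidI)
    fix x y z
    assume "x \<in> carrier (quad_ring p d)" "y \<in> carrier (quad_ring p d)" "z \<in> carrier (quad_ring p d)"
    then show "x \<otimes>\<^bsub>quad_ring p d\<^esub> y \<otimes>\<^bsub>quad_ring p d\<^esub> z =
        x \<otimes>\<^bsub>quad_ring p d\<^esub> (y \<otimes>\<^bsub>quad_ring p d\<^esub> z)"
      by (elim quad_ring_carrierE) (simp only: simps, simp only: algebra_simps)
  next
    fix x y
    assume "x \<in> carrier (quad_ring p d)" "y \<in> carrier (quad_ring p d)"
    then show "x \<otimes>\<^bsub>quad_ring p d\<^esub> y = y \<otimes>\<^bsub>quad_ring p d\<^esub> x"
      by (elim quad_ring_carrierE) (simp only: simps, simp only: algebra_simps)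
    show "x \<otimes>\<^bsub>quad_ring p d\<^esub> y \<in> carrier (quad_ring p d)"
      using \<open>x \<in> _\<close> \<open>y \<in> _\<close> by (elim quad_ring_carrierE) (simp only: simps closed)
  next
    fix x assume "x \<in> carrier (quad_ring p d)"
    then show "\<one>\<^bsub>quad_ring p d\<^esub> \<otimes>\<^bsub>quad_ring p d\<^esub> x = x"
      by (elim quad_ring_carrierE) (simp only: simps, simp)
  qed (simp only: simps closed)
  fix x y z
  assume "x \<in> carrier (quad_ring p d)" "y \<in> carrier (quad_ring p d)" "z \<in> carrier (quad_ring p d)"
  then show "(x \<oplus>\<^bsub>quad_ring p d\<^esub> y) \<otimes>\<^bsub>quad_ring p d\<^esub> z =
        x \<otimes>\<^bsub>quad_ring p d\<^esub> z \<oplus>\<^bsub>quad_ring p d\<^esub> y \<otimes>\<^bsub>quad_ring p d\<^esub> z"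
    by (elim quad_ring_carrierE) (simp only: simps, simp only: algebra_simps)
qed

text \<open>Otherwise \<open>a / y\<close> would be a square root of \<open>d\<close> modulo
  \<open>p\<close>.\<close>

lemma nonresidue_norm:
  fixes p :: nat and a y d :: int
  assumes p: "prime p" and d: "\<not> QuadRes (int p) d"
    and n: "int p dvd a\<^sup>2 - d * y\<^sup>2"
  shows "int p dvd y"
proof (rule ccontr)
  assume "\<not> int p dvd y"
  then have "coprime y (int p)"
    using p by (metis coprime_commute prime_imp_coprime prime_nat_int_transfer)
  then obtain w where w: "[y * w = 1] (mod int p)"
    using cong_solve_coprime_int by blast
  have "[a\<^sup>2 = d * y\<^sup>2] (mod int p)" using n by (simp add: cong_iff_dvd_diff)
  then have "[a\<^sup>2 * w\<^sup>2 = d * y\<^sup>2 * w\<^sup>2] (mod int p)" by (intro cong_mult cong_refl)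
  moreover have "[d * (y * w)\<^sup>2 = d * 1\<^sup>2] (mod int p)"
    using w by (intro cong_mult cong_refl cong_pow)
  ultimately have "[(a * w)\<^sup>2 = d] (mod int p)"
    by (simp add: power_mult_distrib mult.assoc) (metis cong_trans)
  then show False using d by (auto simp: QuadRes_def)
qed

lemma field_quad_ring:
  fixes p :: nat
  assumes p: "prime p" and d: "\<not> QuadRes (int p) d"
  shows "field (quad_ring (int p) d)"
proof -
  have p1: "int p > 1" using p prime_gt_1_nat by auto
  interpret K: cring "quad_ring (int p) d" by (rule cring_quad_ring[OF p1])
  show ?thesis
  proof (rule K.cring_fieldI2)
    fix x assume "x \<in> carrier (quad_ring (int p) d)" "x \<noteq> \<zero>\<^bsub>quad_ring (int p) d\<^esub>"
    then obtain a y where x: "x = (a mod int p, y mod int p)"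
        "a \<in> {0..<int p}" "y \<in> {0..<int p}" "a \<noteq> 0 \<or> y \<noteq> 0"
      by (elim quad_ring_carrierE) (auto simp: quad_ring_zero_one[OF p1])
    have "\<not> int p dvd a\<^sup>2 - d * y\<^sup>2"
    proof
      assume *: "int p dvd a\<^sup>2 - d * y\<^sup>2"
      then have "int p dvd y" using nonresidue_norm[OF p d] by blast
      then have "y = 0" using x by (auto dest: zdvd_imp_le)
      with * have "int p dvd a" using p by (auto simp: prime_dvd_power_iff)
      then have "a = 0" using x by (auto dest: zdvd_imp_le)
      with \<open>y = 0\<close> x show False by simp
    qed
    then have "coprime (a\<^sup>2 - d * y\<^sup>2) (int p)"
      using p by (metis coprime_commute prime_imp_coprime prime_nat_int_transfer)
    then obtain w where w: "[(a\<^sup>2 - d * y\<^sup>2) * w = 1] (mod int p)"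
      using cong_solve_coprime_int by blast
    \<comment> \<open>The inverse is the conjugate \<open>a - y sqrt d\<close> times the inverse
      \<open>w\<close> of the norm.\<close>
    have "(a * (a * w) + d * y * (- y * w)) mod int p = 1 mod int p"
      using w by (simp add: cong_def algebra_simps power2_eq_square)
    moreover have "a * (- y * w) + y * (a * w) = 0" by simp
    ultimately have "x \<otimes>\<^bsub>quad_ring (int p) d\<^esub> ((a * w) mod int p, (- y * w) mod int p) =
        \<one>\<^bsub>quad_ring (int p) d\<^esub>"
      by (simp only: x(1) quad_ring_mult quad_ring_zero_one[OF p1])
    then show "\<exists>b\<in>carrier (quad_ring (int p) d).
        x \<otimes>\<^bsub>quad_ring (int p) d\<^esub> b = \<one>\<^bsub>quad_ring (int p) d\<^esub>"
      using p1 quad_ring_carrierI by (metis less_trans zero_less_one)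
  qed (simp add: quad_ring_def)
qed

lemma card_spow_unity_nonresidue:
  fixes p :: nat
  assumes p: "prime p" and d: "\<not> QuadRes (int p) d" and N: "N > 0"
  shows "card {(a, y) \<in> {0..<int p} \<times> {0..<int p}. spow_unity d N (int p) a y} = gcd N (p\<^sup>2 - 1)"
proof -
  let ?K = "quad_ring (int p) d"
  have p1: "int p > 1" using p prime_gt_1_nat by auto
  interpret K: field ?K by (rule field_quad_ring[OF p d])
  have pow: "(a mod int p, y mod int p) [^]\<^bsub>?K\<^esub> k =
      (fst (spow d a y k) mod int p, snd (spow d a y k) mod int p)" for a y and k :: nat
    by (induction k)
      (simp_all only: K.nat_pow_0 K.nat_pow_Suc quad_ring_mult quad_ring_zero_one[OF p1]
        spow.simps fst_conv snd_conv)
  have pow': "(a, y) [^]\<^bsub>?K\<^esub> N = (fst (spow d a y N) mod int p, snd (spow d a y N) mod int p)"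
    if "0 \<le> a" "a < int p" "0 \<le> y" "y < int p" for a y
    using pow[of a y N] that by simp
  have carrier: "carrier ?K = {0..<int p} \<times> {0..<int p}" by (simp add: quad_ring_def)
  have "{(a, y) \<in> {0..<int p} \<times> {0..<int p}. spow_unity d N (int p) a y} =
      {x \<in> carrier ?K. x [^]\<^bsub>?K\<^esub> N = \<one>\<^bsub>?K\<^esub>}"
    unfolding carrier using pow'
    by (auto simp: spow_unity_def cong_def quad_ring_zero_one[OF p1])
  moreover have "Coset.order ?K = p\<^sup>2"
    by (simp add: Coset.order_def quad_ring_def card_cartesian_product power2_eq_square)
  moreover have "finite (carrier ?K)" by (simp add: quad_ring_def)
  ultimately show ?thesis
    using K.card_roots_of_unity_field[OF _ N] by simp
qed

section \<open>Counting quadratics by the class of their discriminant\<close>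

lemma prime_dvd_mult_int_iff:
  fixes p :: nat and a b :: int
  assumes "prime p"
  shows "int p dvd a * b \<longleftrightarrow> int p dvd a \<or> int p dvd b"
  using assms by (simp add: prime_dvd_mult_iff)

lemma prime_inverse_mod:
  fixes p :: nat and a :: int
  assumes "prime p" "\<not> int p dvd a"
  obtains i where "[a * i = 1] (mod int p)"
proof -
  have "coprime a (int p)"
    using assms by (metis coprime_commute prime_imp_coprime prime_nat_int_transfer)
  then show thesis using that cong_solve_coprime_int by blast
qed

lemma cong_mult_cancel_prime:
  fixes p :: nat and a b k :: int
  assumes "prime p" "\<not> int p dvd k" "[k * a = k * b] (mod int p)"
  shows "[a = b] (mod int p)"
proof -
  have "int p dvd k * (a - b)"
    using assms(3) by (simp add: cong_iff_dvd_diff algebra_simps)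
  then show ?thesis using assms by (simp add: prime_dvd_mult_int_iff cong_iff_dvd_diff)
qed

lemma odd_prime_not_dvd:
  fixes p :: nat
  assumes "prime p" "p \<noteq> 2"
  shows "\<not> int p dvd 2" "\<not> int p dvd 4"
proof -
  have "p > 2" using assms prime_ge_2_nat[of p] by simp
  then show "\<not> int p dvd 2" by (auto dest: zdvd_imp_le)
  then show "\<not> int p dvd 4"
    using prime_dvd_mult_int_iff[OF assms(1), of 2 2] by simp
qed

text \<open>The factor 4 matches the discriminant \<open>4 d y^2\<close> of the quadratic with roots
  \<open>a + y sqrt d\<close> and \<open>a - y sqrt d\<close>.\<close>

definition disc_class :: "nat \<Rightarrow> int \<Rightarrow> nat \<Rightarrow> (int \<times> int) set" where
  "disc_class N d p = {(b, c) \<in> unity_pairs N (int p).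
     \<exists>y. \<not> int p dvd y \<and> [b\<^sup>2 - 4 * c = 4 * d * y\<^sup>2] (mod int p)}"

text \<open>The pairs \<open>(a, \<plusminus>y)\<close> with \<open>y \<noteq> 0\<close> are sent two-to-one to the quadratic with roots
  \<open>a \<plusminus> y \<surd>d\<close>; those with \<open>y = 0\<close> are the roots of unity in the prime field.\<close>

lemma card_spow_unity_eq:
  fixes p :: nat
  assumes p: "prime p" "p \<noteq> 2" and d: "\<not> int p dvd d"
  shows "card {(a, y) \<in> {0..<int p} \<times> {0..<int p}. spow_unity d N (int p) a y} =
    card {a \<in> {0..<int p}. [a ^ N = 1] (mod int p)} + 2 * card (disc_class N d p)"
proof -
  let ?P = "int p"
  have p0: "?P > 0" using p prime_gt_0_nat by simp
  note two = odd_prime_not_dvd[OF p]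
  define T where "T = {(a, y) \<in> {0..<?P} \<times> {0<..<?P}. spow_unity d N ?P a y}"
  define T0 where "T0 = (\<lambda>a. (a, 0::int)) ` {a \<in> {0..<?P}. [a ^ N = 1] (mod ?P)}"
  \<comment> \<open>Minus the trace and the norm of \<open>a + y sqrt d\<close>, reduced modulo
    \<open>p\<close>.\<close>
  define \<phi> where "\<phi> = (\<lambda>(a::int, y). ((- 2 * a) mod ?P, (a\<^sup>2 - d * y\<^sup>2) mod ?P))"
  have finT: "finite T"
    by (rule finite_subset[of _ "{0..<?P} \<times> {0<..<?P}"]) (auto simp: T_def)
  have "{(a, y) \<in> {0..<?P} \<times> {0..<?P}. spow_unity d N ?P a y} = T0 \<union> T"
  proof -
    have "spow_unity d N ?P a 0 \<longleftrightarrow> [a ^ N = 1] (mod ?P)" for a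
      by (simp add: spow_unity_def spow_0)
    moreover have "y \<in> {0..<?P} \<longleftrightarrow> y = 0 \<or> y \<in> {0<..<?P}" for y using p0 by auto
    ultimately show ?thesis unfolding T_def T0_def by (auto simp del: atLeastLessThan_iff)
  qed
  moreover have "T0 \<inter> T = {}" by (auto simp: T_def T0_def)
  moreover have "card T0 = card {a \<in> {0..<?P}. [a ^ N = 1] (mod ?P)}"
    unfolding T0_def by (rule card_image) (simp add: inj_on_def)
  moreover have "finite T0"
    unfolding T0_def by (rule finite_imageI, rule finite_subset[of _ "{0..<?P}"]) auto
  ultimately have "card {(a, y) \<in> {0..<?P} \<times> {0..<?P}. spow_unity d N ?P a y} =
      card {a \<in> {0..<?P}. [a ^ N = 1] (mod ?P)} + card T"
    using finT by (simp add: card_Un_disjoint)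
  also have "card T = 2 * card (disc_class N d p)"
  proof -
    have cop: "coprime y ?P" and ndvd: "\<not> ?P dvd y" if "y \<in> {0<..<?P}" for y
    proof -
      show "\<not> ?P dvd y" using that by (auto dest: zdvd_imp_le)
      then show "coprime y ?P"
        using p by (metis coprime_commute prime_imp_coprime prime_nat_int_transfer)
    qed
    have unity: "spow_unity d N ?P a y \<longleftrightarrow> unity N ?P ((- 2 * a) mod ?P) ((a\<^sup>2 - d * y\<^sup>2) mod ?P)"
      if "y \<in> {0<..<?P}" for a y
      unfolding spow_unity_iff_unity[OF cop[OF that]] by (rule unity_cong) simp_all
    have disc: "[((- 2 * a) mod ?P)\<^sup>2 - 4 * ((a\<^sup>2 - d * y\<^sup>2) mod ?P) = 4 * d * y\<^sup>2] (mod ?P)" for a y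
    proof -
      have "[((- 2 * a) mod ?P)\<^sup>2 - 4 * ((a\<^sup>2 - d * y\<^sup>2) mod ?P) =
          (- 2 * a)\<^sup>2 - 4 * (a\<^sup>2 - d * y\<^sup>2)] (mod ?P)"
        by (intro cong_diff cong_pow cong_mult) simp_all
      also have "(- 2 * a)\<^sup>2 - 4 * (a\<^sup>2 - d * y\<^sup>2) = 4 * d * y\<^sup>2"
        by (simp add: power2_eq_square algebra_simps)
      finally show ?thesis .
    qed
    have image: "\<phi> ` T = disc_class N d p"
    proof (intro subset_antisym subsetI)
      fix x assume "x \<in> \<phi> ` T"
      then obtain a y where x: "x = \<phi> (a, y)" "y \<in> {0<..<?P}" "spow_unity d N ?P a y"
        by (auto simp: T_def)
      then show "x \<in> disc_class N d p"
        using unity[of y a] disc[of a y] ndvd[of y] p0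
        by (auto simp: \<phi>_def disc_class_def unity_pairs_def simp del: mod_minus_eq)
    next
      fix x assume "x \<in> disc_class N d p"
      then obtain b c y where x: "x = (b, c)" "b \<in> {0..<?P}" "c \<in> {0..<?P}" "unity N ?P b c"
        "\<not> ?P dvd y" "[b\<^sup>2 - 4 * c = 4 * d * y\<^sup>2] (mod ?P)"
        by (auto simp: disc_class_def unity_pairs_def)
      \<comment> \<open>Completing the square: the preimage has \<open>a = - b / 2\<close>, and the
        given \<open>y\<close> reduced modulo \<open>p\<close>.\<close>
      obtain i where i: "[2 * i = 1] (mod ?P)" using prime_inverse_mod[OF p(1) two(1)] .
      define a where "a = (- b * i) mod ?P"
      define z where "z = y mod ?P"
      have z: "z \<in> {0<..<?P}"
      proof -
        have "0 \<le> z" "z < ?P" "z \<noteq> 0"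
          using x(5) p0 unfolding z_def dvd_eq_mod_eq_0 by simp_all
        then show ?thesis by simp
      qed
      have "[- 2 * a = - 2 * (- b * i)] (mod ?P)"
        unfolding a_def by (intro cong_mult) simp_all
      also have "- 2 * (- b * i) = b * (2 * i)" by simp
      also have "[b * (2 * i) = b * 1] (mod ?P)" using i by (intro cong_mult) simp_all
      finally have ab: "[- 2 * a = b] (mod ?P)" by simp
      have "[4 * (a\<^sup>2 - d * z\<^sup>2) = (- 2 * a)\<^sup>2 - 4 * d * z\<^sup>2] (mod ?P)"
        by (simp add: power2_eq_square algebra_simps)
      also have "[(- 2 * a)\<^sup>2 - 4 * d * z\<^sup>2 = b\<^sup>2 - 4 * d * y\<^sup>2] (mod ?P)"
        unfolding z_def using ab by (intro cong_diff cong_pow cong_mult) simp_all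
      also have "[b\<^sup>2 - 4 * d * y\<^sup>2 = b\<^sup>2 - (b\<^sup>2 - 4 * c)] (mod ?P)"
        using x(6) by (intro cong_diff) (simp_all add: cong_sym)
      finally have "[4 * (a\<^sup>2 - d * z\<^sup>2) = 4 * c] (mod ?P)" by simp
      then have ac: "[a\<^sup>2 - d * z\<^sup>2 = c] (mod ?P)"
        by (rule cong_mult_cancel_prime[OF p(1) two(2)])
      have \<phi>: "\<phi> (a, z) = x" using ab ac x by (simp add: \<phi>_def cong_def)
      then have "(a, z) \<in> T"
        using unity[OF z, of a] x z p0 by (auto simp: T_def a_def \<phi>_def)
      with \<phi> show "x \<in> \<phi> ` T" by (metis imageI)
    qed
    have fiber: "card {t \<in> T. \<phi> t = x} = 2" if "x \<in> \<phi> ` T" for x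
    proof -
      from that obtain a y where t: "x = \<phi> (a, y)" "a \<in> {0..<?P}" "y \<in> {0<..<?P}" "spow_unity d N ?P a y"
        by (auto simp: T_def)
      have "{t \<in> T. \<phi> t = x} = {(a, y), (a, ?P - y)}"
      proof (intro subset_antisym subsetI)
        fix s assume "s \<in> {t \<in> T. \<phi> t = x}"
        then obtain a' y' where s: "s = (a', y')" "a' \<in> {0..<?P}" "y' \<in> {0<..<?P}" "\<phi> (a', y') = \<phi> (a, y)"
          using t by (auto simp: T_def)
        \<comment> \<open>Equal traces force equal \<open>a\<close>; equal norms then give
          \<open>y'^2 = y^2\<close>, whose solutions in the open range from 0 to \<open>p\<close>
          are \<open>y\<close> and \<open>p - y\<close>.\<close>
        have "[- 2 * a' = - 2 * a] (mod ?P)" using s(4) by (simp add: \<phi>_def cong_def)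
        then have "[a' = a] (mod ?P)" by (rule cong_mult_cancel_prime[OF p(1), rotated]) (use two in simp)
        then have a': "a' = a" using s t by (simp add: cong_def)
        have "[a'\<^sup>2 - d * y'\<^sup>2 = a\<^sup>2 - d * y\<^sup>2] (mod ?P)" using s(4) by (simp add: \<phi>_def cong_def)
        then have "?P dvd d * (y - y') * (y + y')"
          by (simp add: a' cong_iff_dvd_diff power2_eq_square algebra_simps)
        then have "?P dvd y - y' \<or> ?P dvd y + y'"
          using d by (simp add: prime_dvd_mult_int_iff[OF p(1)])
        then show "s \<in> {(a, y), (a, ?P - y)}"
        proof
          assume "?P dvd y - y'"
          then have "[y = y'] (mod ?P)" by (simp add: cong_iff_dvd_diff)
          then show ?thesis using s t a' by (simp add: cong_def)
        next
          assume "?P dvd y + y'"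
          then obtain k where k: "y + y' = ?P * k" by (elim dvdE)
          have "0 < y + y'" "y + y' < ?P * 2" using s t by simp_all
          then have "0 < k" "k < 2"
            unfolding k using p0 by (simp_all add: zero_less_mult_iff)
          then have "k = 1" by simp
          then show ?thesis using k s a' by simp
        qed
      next
        fix s assume "s \<in> {(a, y), (a, ?P - y)}"
        moreover have "\<phi> (a, ?P - y) = \<phi> (a, y)"
        proof -
          have "[?P - y = - y] (mod ?P)" by (simp add: cong_iff_dvd_diff)
          then have "[a\<^sup>2 - d * (?P - y)\<^sup>2 = a\<^sup>2 - d * (- y)\<^sup>2] (mod ?P)"
            by (intro cong_diff cong_mult cong_pow) simp_all
          then show ?thesis by (simp add: \<phi>_def cong_def)
        qed
        moreover have "(a, y) \<in> T" using t by (simp add: T_def)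
        moreover have "(a, ?P - y) \<in> T"
          using t unity[of y a] unity[of "?P - y" a] \<open>\<phi> (a, ?P - y) = \<phi> (a, y)\<close>
          by (simp add: T_def \<phi>_def)
        ultimately show "s \<in> {t \<in> T. \<phi> t = x}" using t by auto
      qed
      moreover have "y \<noteq> ?P - y"
      proof
        assume "y = ?P - y"
        then have "?P dvd 2 * y" by simp
        then show False using ndvd[OF t(3)] two prime_dvd_mult_int_iff[OF p(1)] by blast
      qed
      ultimately show ?thesis by simp
    qed
    have "card T = (\<Sum>x\<in>\<phi> ` T. card {t \<in> T. \<phi> t = x})"
      using sum.image_gen[OF finT, of "\<lambda>_. 1::nat" \<phi>] by simp
    also have "\<dots> = 2 * card (disc_class N d p)"
      using fiber by (simp add: image)
    finally show ?thesis .
  qed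
  finally show ?thesis .
qed

text \<open>The map to \<open>(a + y, a - y)\<close> is invertible for odd \<open>p\<close> and
  sends solutions to independent pairs of roots of unity; \<open>i\<close> plays the role of
  1/2.\<close>

lemma card_spow_unity_1:
  fixes p :: nat
  assumes p: "prime p" "p \<noteq> 2"
  shows "card {(a, y) \<in> {0..<int p} \<times> {0..<int p}. spow_unity 1 N (int p) a y} =
    (card {a \<in> {0..<int p}. [a ^ N = 1] (mod int p)})\<^sup>2"
proof -
  let ?P = "int p" and ?R = "{a \<in> {0..<int p}. [a ^ N = 1] (mod int p)}"
  have p0: "?P > 0" using p prime_gt_0_nat by simp
  note two = odd_prime_not_dvd[OF p]
  have "odd p" using p prime_odd_nat prime_ge_2_nat[OF p(1)] by (metis le_neq_implies_less)
  then have spow_unity: "spow_unity 1 N ?P a y \<longleftrightarrow> [(a + y) ^ N = 1] (mod ?P) \<and> [(a - y) ^ N = 1] (mod ?P)" for a y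
    by (intro spow_unity_1_iff) simp
  have pow: "[(x mod ?P) ^ N = 1] (mod ?P) \<longleftrightarrow> [x ^ N = 1] (mod ?P)" for x
    by (simp add: cong_def power_mod)
  obtain i where i: "[2 * i = 1] (mod ?P)" using prime_inverse_mod[OF p(1) two(1)] .
  have inv2: "[(s + t) * i + (s - t) * i = s] (mod ?P)" "[(s + t) * i - (s - t) * i = t] (mod ?P)" for s t
  proof -
    have "[s * (2 * i) = s * 1] (mod ?P)" "[t * (2 * i) = t * 1] (mod ?P)"
      using i by (intro cong_mult; simp)+
    then show "[(s + t) * i + (s - t) * i = s] (mod ?P)" "[(s + t) * i - (s - t) * i = t] (mod ?P)"
      by (simp_all add: algebra_simps)
  qed
  have "bij_betw (\<lambda>(a, y). ((a + y) mod ?P, (a - y) mod ?P))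
      {(a, y) \<in> {0..<?P} \<times> {0..<?P}. spow_unity 1 N ?P a y} (?R \<times> ?R)"
  proof (rule bij_betw_byWitness[where f' = "\<lambda>(s, t). (((s + t) * i) mod ?P, ((s - t) * i) mod ?P)"])
    show "\<forall>x\<in>{(a, y) \<in> {0..<?P} \<times> {0..<?P}. spow_unity 1 N ?P a y}.
        (\<lambda>(s, t). (((s + t) * i) mod ?P, ((s - t) * i) mod ?P))
          ((\<lambda>(a, y). ((a + y) mod ?P, (a - y) mod ?P)) x) = x"
    proof
      fix x assume "x \<in> {(a, y) \<in> {0..<?P} \<times> {0..<?P}. spow_unity 1 N ?P a y}"
      then obtain a y where ay: "x = (a, y)" "a \<in> {0..<?P}" "y \<in> {0..<?P}" by auto
      have "[((a + y) mod ?P + (a - y) mod ?P) * i = ((a + y) + (a - y)) * i] (mod ?P)"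
        "[((a + y) mod ?P - (a - y) mod ?P) * i = ((a + y) - (a - y)) * i] (mod ?P)"
        by (intro cong_mult cong_add cong_diff; simp)+
      moreover have "((a + y) + (a - y)) * i = (a + 0) * i + (a - 0) * i"
        "((a + y) - (a - y)) * i = (y + 0) * i + (y - 0) * i"
        by (simp_all add: algebra_simps)
      ultimately have "[((a + y) mod ?P + (a - y) mod ?P) * i = a] (mod ?P)"
        "[((a + y) mod ?P - (a - y) mod ?P) * i = y] (mod ?P)"
        using inv2(1)[of a 0] inv2(1)[of y 0] cong_trans by metis+
      then show "(\<lambda>(s, t). (((s + t) * i) mod ?P, ((s - t) * i) mod ?P))
          ((\<lambda>(a, y). ((a + y) mod ?P, (a - y) mod ?P)) x) = x"
        using ay by (simp add: cong_def)
    qed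
    have half: "[((s + t) * i) mod ?P + ((s - t) * i) mod ?P = s] (mod ?P)"
      "[((s + t) * i) mod ?P - ((s - t) * i) mod ?P = t] (mod ?P)" for s t
      using inv2[of s t] by (simp_all add: cong_def mod_simps)
    show "\<forall>x\<in>?R \<times> ?R.
        (\<lambda>(a, y). ((a + y) mod ?P, (a - y) mod ?P))
          ((\<lambda>(s, t). (((s + t) * i) mod ?P, ((s - t) * i) mod ?P)) x) = x"
      using half by (auto simp: cong_def)
    show "(\<lambda>(a, y). ((a + y) mod ?P, (a - y) mod ?P)) `
        {(a, y) \<in> {0..<?P} \<times> {0..<?P}. spow_unity 1 N ?P a y} \<subseteq> ?R \<times> ?R"
      using p0 by (auto simp: spow_unity pow)
    show "(\<lambda>(s, t). (((s + t) * i) mod ?P, ((s - t) * i) mod ?P)) ` (?R \<times> ?R)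
        \<subseteq> {(a, y) \<in> {0..<?P} \<times> {0..<?P}. spow_unity 1 N ?P a y}"
    proof (rule image_subsetI)
      fix x assume "x \<in> ?R \<times> ?R"
      then obtain s t where st: "x = (s, t)" "[s ^ N = 1] (mod ?P)" "[t ^ N = 1] (mod ?P)" by auto
      then have "spow_unity 1 N ?P ((s + t) * i mod ?P) ((s - t) * i mod ?P)"
        using cong_pow[OF half(1)[of s t], of N] cong_pow[OF half(2)[of s t], of N]
        unfolding spow_unity by (meson cong_trans)
      then show "(\<lambda>(s, t). (((s + t) * i) mod ?P, ((s - t) * i) mod ?P)) x
          \<in> {(a, y) \<in> {0..<?P} \<times> {0..<?P}. spow_unity 1 N ?P a y}"
        using p0 by (simp add: st(1))
    qed
  qed
  from bij_betw_same_card[OF this] show ?thesis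
    by (simp add: card_cartesian_product power2_eq_square)
qed

text \<open>The class of square discriminants has \<open>A\<close> members. The additive form avoids
  truncated subtraction and division on naturals.\<close>

lemma card_disc_class_1:
  fixes p :: nat
  assumes p: "prime p" "p \<noteq> 2" and N: "N > 0"
  defines "g \<equiv> gcd N (p - 1)"
  shows "g + 2 * card (disc_class N 1 p) = g\<^sup>2"
proof -
  have "\<not> int p dvd 1" using p prime_gt_1_nat[OF p(1)] by (auto dest: zdvd_imp_le)
  then show ?thesis
    using card_spow_unity_eq[OF p, of 1 N] unfolding card_spow_unity_1[OF p] g_def
      card_roots_of_unity_mod_prime[OF p(1) N] by simp
qed

lemma card_disc_class_nonresidue:
  fixes p :: nat
  assumes p: "prime p" "p \<noteq> 2" and N: "N > 0" and d: "\<not> QuadRes (int p) d"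
  shows "gcd N (p - 1) + 2 * card (disc_class N d p) = gcd N (p\<^sup>2 - 1)"
proof -
  have "\<not> int p dvd d"
  proof
    assume "int p dvd d"
    then have "[0\<^sup>2 = d] (mod int p)" by (simp add: cong_iff_dvd_diff)
    then show False using d unfolding QuadRes_def by blast
  qed
  from card_spow_unity_eq[OF p this, of N] show ?thesis
    unfolding card_spow_unity_nonresidue[OF p(1) d N] card_roots_of_unity_mod_prime[OF p(1) N] by simp
qed

section \<open>Quadratic residues and the Legendre symbol\<close>

text \<open>Squaring takes 1 and -1 to the same value, so on a finite set it is not injective and
  hence not surjective.\<close>

lemma exists_nonresidue:
  fixes p :: nat
  assumes p: "prime p" "p \<noteq> 2"
  obtains d where "\<not> QuadRes (int p) d"
proof -
  have p2: "p > 2" using p prime_ge_2_nat[of p] by simp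
  have "\<exists>d. \<not> QuadRes (int p) d"
  proof (rule ccontr)
    assume "\<nexists>d. \<not> QuadRes (int p) d"
    then have sq: "\<exists>y. [y\<^sup>2 = d] (mod int p)" for d by (simp add: QuadRes_def)
    let ?f = "\<lambda>y. y\<^sup>2 mod int p"
    have "?f ` {0..<int p} = {0..<int p}"
    proof (intro subset_antisym subsetI)
      fix d assume d: "d \<in> {0..<int p}"
      obtain y where "[y\<^sup>2 = d] (mod int p)" using sq by blast
      then have "?f (y mod int p) = d" using d by (simp add: cong_def power_mod)
      moreover have "y mod int p \<in> {0..<int p}" using p2 by simp
      ultimately show "d \<in> ?f ` {0..<int p}" by blast
    qed (use p2 in auto)
    then have "inj_on ?f {0..<int p}" by (intro eq_card_imp_inj_on) auto
    moreover have "?f (int p - 1) = ?f 1"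
    proof -
      have "[int p - 1 = - 1] (mod int p)" by (simp add: cong_iff_dvd_diff)
      from cong_pow[OF this, of 2] show ?thesis by (simp add: cong_def)
    qed
    ultimately have "int p - 1 = 1" using p2 by (elim inj_onD) auto
    then show False using p2 by simp
  qed
  then show thesis using that by blast
qed

text \<open>Euler's criterion gives the identity modulo \<open>p\<close>; both sides lie between -1
  and 1, so a difference divisible by \<open>p > 2\<close> is zero.\<close>

lemma Legendre_mult:
  fixes p :: nat
  assumes p: "prime p" "p \<noteq> 2"
  shows "Legendre (a * b) (int p) = Legendre a (int p) * Legendre b (int p)"
proof -
  have p2: "p > 2" using p prime_ge_2_nat[of p] by simp
  let ?e = "(p - 1) div 2"
  have "[Legendre (a * b) (int p) = a ^ ?e * b ^ ?e] (mod int p)"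
    using euler_criterion[OF p(1) p2] by (simp flip: power_mult_distrib)
  also have "[a ^ ?e * b ^ ?e = Legendre a (int p) * Legendre b (int p)] (mod int p)"
    using euler_criterion[OF p(1) p2] by (intro cong_mult) (simp_all add: cong_sym)
  finally have "int p dvd Legendre (a * b) (int p) - Legendre a (int p) * Legendre b (int p)"
    by (simp add: cong_iff_dvd_diff)
  moreover have "\<bar>Legendre (a * b) (int p) - Legendre a (int p) * Legendre b (int p)\<bar> \<le> 2"
    by (simp add: Legendre_def)
  moreover have "z = 0" if "int p dvd z" "\<bar>z\<bar> \<le> 2" for z
    using that p2 dvd_imp_le_int[of z "int p"] by (cases "z = 0") simp_all
  ultimately show ?thesis by (metis eq_iff_diff_eq_0)
qed

lemma Legendre_cong:
  assumes "[a = b] (mod p)"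
  shows "Legendre a p = Legendre b p"
proof -
  have "[a = 0] (mod p) \<longleftrightarrow> [b = 0] (mod p)" using assms by (meson cong_sym cong_trans)
  moreover have "QuadRes p a \<longleftrightarrow> QuadRes p b"
    using assms unfolding QuadRes_def by (meson cong_sym cong_trans)
  ultimately show ?thesis by (simp add: Legendre_def)
qed

text \<open>Equal nonzero symbols make \<open>z d\<close> a square, and dividing by \<open>d\<close>
  turns this into \<open>z\<close> being \<open>d\<close> times a square.\<close>

lemma disc_class_iff_Legendre:
  fixes p :: nat
  assumes p: "prime p" "p \<noteq> 2" and d: "\<not> int p dvd d"
  shows "(\<exists>y. \<not> int p dvd y \<and> [z = 4 * d * y\<^sup>2] (mod int p)) \<longleftrightarrow>
    Legendre z (int p) = Legendre d (int p)"
proof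
  note two = odd_prime_not_dvd[OF p]
  have sq: "Legendre (y\<^sup>2) (int p) = 1" if "\<not> int p dvd y" for y
  proof -
    have "QuadRes (int p) (y\<^sup>2)" unfolding QuadRes_def by (rule exI[of _ y]) simp
    moreover have "\<not> [y\<^sup>2 = 0] (mod int p)"
      using that prime_dvd_mult_int_iff[OF p(1), of y y] by (simp add: cong_0_iff power2_eq_square)
    ultimately show ?thesis by (simp add: Legendre_def)
  qed
  {
    assume "\<exists>y. \<not> int p dvd y \<and> [z = 4 * d * y\<^sup>2] (mod int p)"
    then obtain y where y: "\<not> int p dvd y" "[z = 4 * d * y\<^sup>2] (mod int p)" by blast
    have "\<not> int p dvd 2 * y" using y two prime_dvd_mult_int_iff[OF p(1)] by blast
    have "Legendre z (int p) = Legendre (d * (2 * y)\<^sup>2) (int p)"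
      using y by (intro Legendre_cong) (simp add: power2_eq_square algebra_simps)
    also have "\<dots> = Legendre d (int p)"
      using sq[OF \<open>\<not> int p dvd 2 * y\<close>] by (simp add: Legendre_mult[OF p])
    finally show "Legendre z (int p) = Legendre d (int p)" .
  }
  assume L: "Legendre z (int p) = Legendre d (int p)"
  have "Legendre d (int p) * Legendre d (int p) = 1"
    using d by (simp add: Legendre_def cong_0_iff)
  then have "Legendre (z * d) (int p) = 1" using L by (simp add: Legendre_mult[OF p])
  then have "QuadRes (int p) (z * d)" by (auto simp: Legendre_def split: if_splits)
  then obtain x where x: "[x\<^sup>2 = z * d] (mod int p)" by (auto simp: QuadRes_def)
  have "\<not> int p dvd 2 * d" using d two prime_dvd_mult_int_iff[OF p(1)] by blast
  then obtain j where j: "[2 * d * j = 1] (mod int p)" using prime_inverse_mod[OF p(1)] by blast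
  \<comment> \<open>Here \<open>y = x / (2 d)\<close>, so that
    \<open>4 d y^2 = x^2 / d = z\<close>.\<close>
  define y where "y = x * j"
  have "[(x * (2 * d * j))\<^sup>2 = (x * 1)\<^sup>2] (mod int p)"
    using j by (intro cong_pow cong_mult) simp_all
  also have "(x * (2 * d * j))\<^sup>2 = d * (4 * d * y\<^sup>2)"
    by (simp add: y_def power2_eq_square algebra_simps)
  finally have "[d * (4 * d * y\<^sup>2) = z * d] (mod int p)" using x by (auto intro: cong_trans)
  then have "[d * (4 * d * y\<^sup>2) = d * z] (mod int p)" by (simp add: mult.commute)
  then have z: "[4 * d * y\<^sup>2 = z] (mod int p)" by (rule cong_mult_cancel_prime[OF p(1) d])
  have "\<not> int p dvd y"
  proof
    assume "int p dvd y"
    then have "int p dvd 4 * d * y\<^sup>2" by (simp add: power2_eq_square)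
    then have "[z = 0] (mod int p)" using z by (metis cong_0_iff cong_dvd_iff)
    then have "Legendre z (int p) = 0" by (simp add: Legendre_def)
    then show False using L d by (simp add: Legendre_def cong_0_iff split: if_splits)
  qed
  then show "\<exists>y. \<not> int p dvd y \<and> [z = 4 * d * y\<^sup>2] (mod int p)" using z cong_sym by blast
qed

text \<open>An odd discriminant \<open>b\<^sup>2 - 4 c\<close> with \<open>c\<close> odd is \<open>5\<close> modulo \<open>8\<close>, whence the constant value at \<open>2\<close>.\<close>

definition kron :: "nat \<Rightarrow> int \<Rightarrow> int" where
  "kron p z = (if p = 2 then -1 else Legendre z (int p))"

section \<open>Symbol-weighted sums modulo a prime\<close>

lemma finite_unity_pairs: "finite (unity_pairs N m)"
  by (rule finite_subset[of _ "{0..<m} \<times> {0..<m}"]) (auto simp: unity_pairs_def)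

text \<open>Symbol 1 selects the class of \<open>d = 1\<close> and symbol -1 that of any nonresidue
  \<open>d\<close>; the sum is \<open>A + (-1)^e B\<close>.\<close>

lemma sum_kron_odd_prime:
  fixes p :: nat
  assumes p: "prime p" "p \<noteq> 2" and N: "N > 0"
  defines "g \<equiv> real (gcd N (p - 1))" and "h \<equiv> real (gcd N (p\<^sup>2 - 1))"
  shows "(\<Sum>(b, c)\<in>unity_pairs N (int p). if int p dvd b\<^sup>2 - 4 * c then 0
      else real_of_int (kron p (b\<^sup>2 - 4 * c) ^ e)) = (g\<^sup>2 - g) / 2 + (- 1) ^ e * ((h - g) / 2)"
proof -
  let ?L = "\<lambda>x. Legendre ((fst x)\<^sup>2 - 4 * snd x) (int p)"
  obtain d where d: "\<not> QuadRes (int p) d" using exists_nonresidue[OF p] .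
  have d0: "\<not> int p dvd d"
  proof
    assume "int p dvd d"
    then have "[0\<^sup>2 = d] (mod int p)" by (simp add: cong_iff_dvd_diff)
    then show False using d unfolding QuadRes_def by blast
  qed
  have one: "\<not> int p dvd 1" using p prime_gt_1_nat[OF p(1)] by (auto dest: zdvd_imp_le)
  have "QuadRes (int p) 1" unfolding QuadRes_def by (rule exI[of _ 1]) simp
  then have L1: "Legendre 1 (int p) = 1" using one by (simp add: Legendre_def cong_0_iff)
  have Ld: "Legendre d (int p) = -1" using d d0 by (simp add: Legendre_def cong_0_iff)
  have plus: "disc_class N 1 p = {x \<in> unity_pairs N (int p). ?L x = 1}"
    unfolding disc_class_def disc_class_iff_Legendre[OF p one] L1 by auto
  have minus: "disc_class N d p = {x \<in> unity_pairs N (int p). ?L x = -1}"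
    unfolding disc_class_def disc_class_iff_Legendre[OF p d0] Ld by auto
  have "(if int p dvd z then 0 else real_of_int (kron p z ^ e)) =
      (if Legendre z (int p) = 1 then 1 else 0) + (if Legendre z (int p) = - 1 then (- 1) ^ e else 0)" for z
    using p by (auto simp: kron_def Legendre_def cong_0_iff)
  then have "(\<Sum>(b, c)\<in>unity_pairs N (int p). if int p dvd b\<^sup>2 - 4 * c then 0
      else real_of_int (kron p (b\<^sup>2 - 4 * c) ^ e)) =
    (\<Sum>x\<in>unity_pairs N (int p). if ?L x = 1 then 1 else 0) +
    (\<Sum>x\<in>unity_pairs N (int p). if ?L x = -1 then (- 1) ^ e else 0)"
    by (simp add: case_prod_unfold sum.distrib)
  also have "\<dots> = real (card (disc_class N 1 p)) + (- 1) ^ e * real (card (disc_class N d p))"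
    unfolding plus minus by (simp add: finite_unity_pairs sum.If_cases Int_def mult.commute)
  also have "real (card (disc_class N 1 p)) = (g\<^sup>2 - g) / 2"
  proof -
    have "real (gcd N (p - 1) + 2 * card (disc_class N 1 p)) = real ((gcd N (p - 1))\<^sup>2)"
      using card_disc_class_1[OF p N] by simp
    then show ?thesis by (simp add: g_def)
  qed
  also have "real (card (disc_class N d p)) = (h - g) / 2"
  proof -
    have "real (gcd N (p - 1) + 2 * card (disc_class N d p)) = h"
      using card_disc_class_nonresidue[OF p N d] unfolding h_def by simp
    then show ?thesis by (simp add: g_def)
  qed
  finally show ?thesis .
qed

text \<open>Modulo 2 only \<open>x\<^sup>2 + x + 1\<close> has odd discriminant and odd constant term; there \<open>x ^ 3 = 1\<close>.\<close>

lemma unity_two_iff: "unity N 2 1 1 \<longleftrightarrow> 3 dvd N"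
proof -
  have per: "xpow 1 1 (m + 3 * k) = xpow 1 1 m" for m k
    by (induction k) (simp_all add: numeral_3_eq_3 prod_eq_iff)
  have "xpow 1 1 N = xpow 1 1 (N mod 3)"
    using per[of "N mod 3" "N div 3"] by simp
  moreover have "N mod 3 = 0 \<or> N mod 3 = 1 \<or> N mod 3 = 2" by linarith
  ultimately show ?thesis
    by (auto simp: unity_def dvd_eq_mod_eq_0 numeral_2_eq_2)
qed

lemma sum_kron_two:
  assumes N: "odd N"
  shows "(\<Sum>(b, c)\<in>unity_pairs N 2. if 2 dvd b\<^sup>2 - 4 * c then 0
      else real_of_int (kron 2 (b\<^sup>2 - 4 * c) ^ e)) = (- 1) ^ e * ((real (gcd N 3) - 1) / 2)"
proof -
  obtain M where M: "N = Suc M" using N by (cases N) auto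
  \<comment> \<open>Odd discriminant means \<open>b = 1\<close>. The candidate
    \<open>x^2 + x\<close> fails because 0 is a root of it but not of
    \<open>x ^ N - 1\<close>.\<close>
  have "\<not> unity N 2 1 0"
    by (simp add: unity_def M)
  moreover have "{0..<2::int} = {0, 1}" by auto
  ultimately have "{x \<in> unity_pairs N 2. \<not> even ((fst x)\<^sup>2 - 4 * snd x)} = (if 3 dvd N then {(1, 1)} else {})"
    by (auto simp: unity_pairs_def unity_two_iff)
  moreover have "(\<Sum>(b, c)\<in>unity_pairs N 2. if 2 dvd b\<^sup>2 - 4 * c then 0
      else real_of_int (kron 2 (b\<^sup>2 - 4 * c) ^ e)) =
      (\<Sum>x\<in>{x \<in> unity_pairs N 2. \<not> even ((fst x)\<^sup>2 - 4 * snd x)}. (- 1) ^ e)"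
    unfolding sum.inter_filter[OF finite_unity_pairs] by (rule sum.cong) (auto simp: kron_def)
  moreover have "gcd N 3 = (if 3 dvd N then 3 else 1)"
  proof (cases "3 dvd N")
    case False
    then have "coprime 3 N" by (intro prime_imp_coprime) auto
    then have "gcd N 3 = 1" by (metis coprime_imp_gcd_eq_1 gcd.commute)
    then show ?thesis using False by simp
  qed (simp add: gcd_proj2_if_dvd)
  ultimately show ?thesis by simp
qed

text \<open>At \<open>p = 2\<close> the general formula has \<open>g = 1\<close> and
  \<open>p^2 - 1 = 3\<close>, which is the value found separately. That \<open>p\<close> does not
  divide \<open>N\<close> makes \<open>N\<close> odd there, and nonzero in general.\<close>

lemma sum_kron_prime:
  fixes p :: nat
  assumes p: "prime p" "\<not> p dvd N"
  defines "g \<equiv> real (gcd N (p - 1))" and "h \<equiv> real (gcd N (p\<^sup>2 - 1))"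
  shows "(\<Sum>(b, c)\<in>unity_pairs N (int p). if int p dvd b\<^sup>2 - 4 * c then 0
      else real_of_int (kron p (b\<^sup>2 - 4 * c) ^ e)) = (g\<^sup>2 - g) / 2 + (- 1) ^ e * ((h - g) / 2)"
proof (cases "p = 2")
  case True
  then show ?thesis using sum_kron_two[of N e] p unfolding g_def h_def True by simp
next
  case False
  have "N > 0" using p by (intro Nat.gr0I) auto
  from sum_kron_odd_prime[OF p(1) False this] show ?thesis unfolding g_def h_def .
qed

text \<open>Exponent \<open>e = 0\<close> counts the quadratics dividing \<open>x ^ N - 1\<close>; \<open>e = r\<close> weights them by their
  Jacobi symbol modulo \<open>p ^ r\<close>.\<close>

definition weight :: "nat \<Rightarrow> nat \<Rightarrow> nat \<Rightarrow> nat \<Rightarrow> int \<Rightarrow> int \<Rightarrow> real" where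
  "weight N p r e b c = (if unity N (int p ^ r) b c \<and> \<not> int p dvd b\<^sup>2 - 4 * c
     then real_of_int (kron p (b\<^sup>2 - 4 * c) ^ e) else 0)"

lemma weight_cong:
  assumes "[b = b'] (mod int p ^ r)" "[c = c'] (mod int p ^ r)" "r \<ge> 1"
  shows "weight N p r e b c = weight N p r e b' c'"
proof -
  have "int p dvd int p ^ r" using assms by (intro dvd_power) auto
  then have "[b = b'] (mod int p)" "[c = c'] (mod int p)"
    using assms cong_dvd_modulus by blast+
  then have disc: "[b\<^sup>2 - 4 * c = b'\<^sup>2 - 4 * c'] (mod int p)"
    by (intro cong_diff cong_pow cong_mult cong_refl)
  then show ?thesis
    using unity_cong[OF assms(1,2)] cong_dvd_iff[OF disc] Legendre_cong[OF disc]
    by (simp add: weight_def kron_def)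
qed

text \<open>Apart from \<open>unity\<close>, the weight depends only on the discriminant modulo
  \<open>p\<close>, so the lifting bijections reduce the sum to modulus \<open>p\<close>.\<close>

lemma sum_weight_prime_power:
  fixes p :: nat
  assumes p: "prime p" "\<not> p dvd N" and r: "r \<ge> 1"
  defines "g \<equiv> real (gcd N (p - 1))" and "h \<equiv> real (gcd N (p\<^sup>2 - 1))"
  shows "(\<Sum>b\<in>{0..<int p ^ r}. \<Sum>c\<in>{0..<int p ^ r}. weight N p r e b c) =
    (g\<^sup>2 - g) / 2 + (- 1) ^ e * ((h - g) / 2)"
proof -
  let ?F = "\<lambda>b c. if int p dvd b\<^sup>2 - 4 * c then 0 else real_of_int (kron p (b\<^sup>2 - 4 * c) ^ e)"
  have F: "?F (b mod int p) (c mod int p) = ?F b c" for b c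
  proof -
    have disc: "[(b mod int p)\<^sup>2 - 4 * (c mod int p) = b\<^sup>2 - 4 * c] (mod int p)"
      by (intro cong_diff cong_pow cong_mult) simp_all
    show ?thesis
      using cong_dvd_iff[OF disc] Legendre_cong[OF disc] by (simp add: kron_def)
  qed
  have "(\<Sum>b\<in>{0..<int p ^ r}. \<Sum>c\<in>{0..<int p ^ r}. weight N p r e b c) =
      (\<Sum>x\<in>{0..<int p ^ r} \<times> {0..<int p ^ r}.
        if unity N (int p ^ r) (fst x) (snd x) then ?F (fst x) (snd x) else 0)"
    unfolding sum.cartesian_product by (rule sum.cong) (auto simp: weight_def)
  also have "\<dots> = (\<Sum>x\<in>{x \<in> {0..<int p ^ r} \<times> {0..<int p ^ r}.
        unity N (int p ^ r) (fst x) (snd x)}. ?F (fst x) (snd x))"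
    by (rule sum.inter_filter[symmetric]) simp
  also have "\<dots> = (\<Sum>(b, c)\<in>unity_pairs N (int p ^ r). ?F (b mod int p) (c mod int p))"
    unfolding F by (rule sum.cong) (auto simp: unity_pairs_def)
  also have "\<dots> = (\<Sum>(b, c)\<in>unity_pairs N (int p). ?F b c)"
    by (rule sum_unity_pairs_prime_power[OF p r])
  also have "\<dots> = (g\<^sup>2 - g) / 2 + (- 1) ^ e * ((h - g) / 2)"
    unfolding g_def h_def by (rule sum_kron_prime[OF p])
  finally show ?thesis .
qed

section \<open>From the ring of polynomials modulo \<open>n\<close> to integer polynomials\<close>

lemma residues_int: "n > 1 \<Longrightarrow> residues (int n)"
  by unfold_locales simp

lemma UP_cring_Zmod: "n > 1 \<Longrightarrow> UP_cring (Zmod n)"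
  using residues.cring[OF residues_int] by (simp add: UP_cring_def)

lemma reduce_poly_closed:
  assumes "n > 1"
  shows "reduce_poly n f \<in> carrier (ZmodX n)"
proof -
  interpret R: residues "int n" "Zmod n" using residues_int[OF assms] .
  have "bound \<zero>\<^bsub>Zmod n\<^esub> (Polynomial.degree f) (reduce_poly n f)"
    by (auto simp: reduce_poly_def R.res_zero_eq coeff_eq_0)
  then show ?thesis
    by (auto simp: UP_def reduce_poly_def intro!: mem_upI)
qed

lemma coeff_UP: "q \<in> carrier (ZmodX n) \<Longrightarrow> up_ring.coeff (ZmodX n) q i = q i"
  by (simp add: UP_def)

lemma reduce_poly_surj:
  assumes "n > 1" "q \<in> carrier (ZmodX n)"
  obtains f where "q = reduce_poly n f"
proof -
  interpret R: residues "int n" "Zmod n" using residues_int[OF assms(1)] .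
  from assms have "q \<in> up (Zmod n)" by (simp add: UP_def)
  then obtain m where m: "bound \<zero>\<^bsub>Zmod n\<^esub> m q" and q: "\<And>i. q i \<in> carrier (Zmod n)"
    by (auto simp: up_def)
  define f where "f = (\<Sum>i\<le>m. Polynomial.monom (q i) i)"
  have "reduce_poly n f i = q i" for i
  proof -
    have "Polynomial.coeff f i = (if i \<le> m then q i else 0)"
      by (simp add: f_def coeff_sum)
    moreover have "q i = 0" if "i > m" using m that by (auto simp: bound_def R.res_zero_eq)
    moreover have "q i mod int n = q i" using q[of i] by (simp add: R.res_carrier_eq)
    ultimately show ?thesis by (simp add: reduce_poly_def)
  qed
  then have "q = reduce_poly n f" by (intro ext) simp
  then show thesis by (rule that)
qed

lemma reduce_poly_mult:
  assumes "n > 1"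
  shows "reduce_poly n (f * g) = reduce_poly n f \<otimes>\<^bsub>ZmodX n\<^esub> reduce_poly n g"
proof
  fix i
  interpret R: residues "int n" "Zmod n" using residues_int[OF assms] .
  have "(reduce_poly n f \<otimes>\<^bsub>ZmodX n\<^esub> reduce_poly n g) i =
      (\<Oplus>\<^bsub>Zmod n\<^esub>j\<in>{..i}. reduce_poly n f j \<otimes>\<^bsub>Zmod n\<^esub> reduce_poly n g (i - j))"
    using reduce_poly_closed[OF assms, of f] reduce_poly_closed[OF assms, of g]
    by (simp add: UP_def)
  also have "\<dots> = (\<Oplus>\<^bsub>Zmod n\<^esub>j\<in>{..i}. (Polynomial.coeff f j * Polynomial.coeff g (i - j)) mod int n)"
    by (simp add: reduce_poly_def R.mult_cong)
  also have "\<dots> = reduce_poly n (f * g) i"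
    by (simp add: R.sum_cong reduce_poly_def coeff_mult)
  finally show "reduce_poly n (f * g) i = (reduce_poly n f \<otimes>\<^bsub>ZmodX n\<^esub> reduce_poly n g) i" ..
qed

lemma reduce_poly_add:
  assumes "n > 1"
  shows "reduce_poly n (f + g) = reduce_poly n f \<oplus>\<^bsub>ZmodX n\<^esub> reduce_poly n g"
proof
  fix i
  interpret R: residues "int n" "Zmod n" using residues_int[OF assms] .
  show "reduce_poly n (f + g) i = (reduce_poly n f \<oplus>\<^bsub>ZmodX n\<^esub> reduce_poly n g) i"
    using reduce_poly_closed[OF assms, of f] reduce_poly_closed[OF assms, of g]
    by (simp add: UP_def reduce_poly_def R.add_cong)
qed

lemma reduce_poly_diff:
  assumes "n > 1"
  shows "reduce_poly n (f - g) = reduce_poly n f \<ominus>\<^bsub>ZmodX n\<^esub> reduce_poly n g"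
proof -
  interpret P: UP_cring "Zmod n" "ZmodX n" using UP_cring_Zmod[OF assms] .
  have "reduce_poly n (f - g) \<oplus>\<^bsub>ZmodX n\<^esub> reduce_poly n g = reduce_poly n f"
    using reduce_poly_add[OF assms, of "f - g" g] by simp
  then show ?thesis
    using reduce_poly_closed[OF assms]
    by (metis P.P.add.inv_closed P.P.add.inv_solve_right P.P.minus_eq)
qed

lemma reduce_poly_one: "n > 1 \<Longrightarrow> reduce_poly n 1 = \<one>\<^bsub>ZmodX n\<^esub>"
proof
  fix i assume "n > 1"
  interpret R: residues "int n" "Zmod n" using residues_int[OF \<open>n > 1\<close>] .
  show "reduce_poly n 1 i = \<one>\<^bsub>ZmodX n\<^esub> i"
    using \<open>n > 1\<close> by (auto simp: UP_def reduce_poly_def R.res_one_eq R.res_zero_eq)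
qed

lemma X_pow_eq_reduce_poly: "n > 1 \<Longrightarrow> X_pow n k = reduce_poly n ([:0, 1:] ^ k)"
proof
  fix i assume "n > 1"
  interpret R: residues "int n" "Zmod n" using residues_int[OF \<open>n > 1\<close>] .
  have "[:0, 1:] ^ k = (Polynomial.monom 1 k :: int poly)" by (simp add: monom_altdef)
  then show "X_pow n k i = reduce_poly n ([:0, 1:] ^ k) i"
    using \<open>n > 1\<close>
    by (auto simp: X_pow_def UP_def reduce_poly_def R.res_one_eq R.res_zero_eq R.res_carrier_eq)
qed

lemma reduce_poly_eq_iff: "reduce_poly n f = reduce_poly n g \<longleftrightarrow> (\<exists>s. f = g + smult (int n) s)"
proof
  assume "reduce_poly n f = reduce_poly n g"
  then have "Polynomial.coeff f i mod int n = Polynomial.coeff g i mod int n" for i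
    by (metis reduce_poly_def)
  then have "[:int n:] dvd f - g"
    by (simp add: const_poly_dvd_iff mod_eq_dvd_iff)
  then obtain s where "f - g = [:int n:] * s" by (elim dvdE)
  then have "f = g + smult (int n) s" by (simp add: algebra_simps)
  then show "\<exists>s. f = g + smult (int n) s" ..
qed (auto simp: reduce_poly_def)

lemma dvd_mod_iff_reduce_poly:
  assumes "n > 1"
  shows "dvd_mod (int n) f g \<longleftrightarrow>
    (\<exists>q\<in>carrier (ZmodX n). reduce_poly n g = q \<otimes>\<^bsub>ZmodX n\<^esub> reduce_poly n f)"
proof
  assume "dvd_mod (int n) f g"
  then obtain q s where "g = f * q + smult (int n) s" by (auto simp: dvd_mod_def)
  then have "reduce_poly n g = reduce_poly n (q * f)"
    unfolding reduce_poly_eq_iff by (metis mult.commute)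
  then show "\<exists>q\<in>carrier (ZmodX n). reduce_poly n g = q \<otimes>\<^bsub>ZmodX n\<^esub> reduce_poly n f"
    using reduce_poly_mult[OF assms] reduce_poly_closed[OF assms] by metis
next
  assume "\<exists>q\<in>carrier (ZmodX n). reduce_poly n g = q \<otimes>\<^bsub>ZmodX n\<^esub> reduce_poly n f"
  then obtain q where "reduce_poly n g = reduce_poly n (q * f)"
    using reduce_poly_surj[OF assms] reduce_poly_mult[OF assms] by metis
  then show "dvd_mod (int n) f g"
    unfolding dvd_mod_def reduce_poly_eq_iff by (metis mult.commute)
qed

section \<open>Monic polynomials and greatest common monic divisors\<close>

lemma deg_reduce_poly_monic:
  assumes "n > 1" "lead_coeff f = 1"
  shows "deg (Zmod n) (reduce_poly n f) = Polynomial.degree f"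
proof -
  interpret R: residues "int n" "Zmod n" using residues_int[OF assms(1)] .
  interpret P: UP_cring "Zmod n" "ZmodX n" using UP_cring_Zmod[OF assms(1)] .
  note closed = reduce_poly_closed[OF assms(1), of f]
  show ?thesis
  proof (rule antisym)
    show "deg (Zmod n) (reduce_poly n f) \<le> Polynomial.degree f"
    proof (rule P.deg_aboveI[OF _ closed])
      fix m assume "Polynomial.degree f < m"
      then show "up_ring.coeff (ZmodX n) (reduce_poly n f) m = \<zero>\<^bsub>Zmod n\<^esub>"
        unfolding coeff_UP[OF closed] by (simp add: reduce_poly_def R.res_zero_eq coeff_eq_0)
    qed
    show "Polynomial.degree f \<le> deg (Zmod n) (reduce_poly n f)"
    proof (rule P.deg_belowI[OF _ closed])
      show "up_ring.coeff (ZmodX n) (reduce_poly n f) (Polynomial.degree f) \<noteq> \<zero>\<^bsub>Zmod n\<^esub>"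
        unfolding coeff_UP[OF closed] using assms by (simp add: reduce_poly_def R.res_zero_eq)
    qed
  qed
qed

lemma monic_mod_reduce_poly:
  assumes "n > 1" "lead_coeff f = 1"
  shows "monic_mod n (reduce_poly n f)"
proof -
  interpret R: residues "int n" "Zmod n" using residues_int[OF assms(1)] .
  note closed = reduce_poly_closed[OF assms(1), of f]
  show ?thesis
    unfolding monic_mod_def coeff_UP[OF closed] deg_reduce_poly_monic[OF assms]
    using assms closed by (simp add: reduce_poly_def R.res_one_eq)
qed

text \<open>A lift with leading coefficient exactly 1 keeps its degree under reduction, and degrees
  add over the integers; this gets around zero divisors in Z/n.\<close>

lemma monic_mod_lift:
  assumes "n > 1" "monic_mod n q"
  obtains f where "q = reduce_poly n f" "lead_coeff f = 1"
proof -
  interpret R: residues "int n" "Zmod n" using residues_int[OF assms(1)] .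
  interpret P: UP_cring "Zmod n" "ZmodX n" using UP_cring_Zmod[OF assms(1)] .
  define d where "d = deg (Zmod n) q"
  have q: "q \<in> carrier (ZmodX n)" and qd: "q d = 1"
    using assms(2) by (auto simp: monic_mod_def d_def coeff_UP R.res_one_eq)
  define f where "f = (\<Sum>i\<le>d. Polynomial.monom (q i) i)"
  have coeff: "Polynomial.coeff f i = (if i \<le> d then q i else 0)" for i
    by (simp add: f_def coeff_sum)
  have "q i = reduce_poly n f i" for i
  proof -
    have "q i = 0" if "i > d"
      using P.deg_aboveD[OF _ q, of i] that by (simp add: d_def coeff_UP[OF q] R.res_zero_eq)
    moreover have "q i \<in> carrier (Zmod n)" using P.coeff_closed[OF q, of i] by (simp add: coeff_UP[OF q])
    then have "q i mod int n = q i" by (simp add: R.res_carrier_eq)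
    ultimately show ?thesis by (simp add: reduce_poly_def coeff)
  qed
  then have "q = reduce_poly n f" by (rule ext)
  moreover have "Polynomial.degree f = d"
    by (intro antisym degree_le le_degree) (auto simp: coeff qd)
  then have "lead_coeff f = 1" by (simp add: coeff qd)
  ultimately show thesis by (rule that)
qed

lemma monic_X_power_minus_X:
  assumes "k > 1"
  shows "lead_coeff ([:0, 1:] ^ k - [:0, 1:] :: int poly) = 1"
proof -
  have "Polynomial.degree ([:0, 1:] ^ k :: int poly) = k" by (simp add: degree_power_eq)
  then have "Polynomial.degree (- [:0, 1:] :: int poly) < Polynomial.degree ([:0, 1:] ^ k :: int poly)"
    using assms by simp
  from lead_coeff_add_le[OF this]
  have "lead_coeff ([:0, 1:] ^ k + - [:0, 1:] :: int poly) = lead_coeff ([:0, 1:] ^ k)"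
    by (simp only: add.commute)
  moreover have "lead_coeff ([:0, 1:] ^ k :: int poly) = 1"
    by (simp only: lead_coeff_power) simp
  ultimately show ?thesis by (simp only: diff_conv_add_uminus)
qed

text \<open>The ideals agree iff \<open>x ^ k - x\<close> lies in the ideal of \<open>f\<close>.
  Only this case of the relation is needed, with \<open>F\<^sub>1 = f\<close> and with
  \<open>F\<^sub>2 = f\<^sub>1 = 1\<close>; \<open>k > 1\<close> makes \<open>x ^ k - x\<close>
  monic.\<close>

lemma is_gcmd_self_iff:
  assumes "n > 1" "k > 1" "lead_coeff f = 1"
  shows "is_gcmd n (X_pow n k \<ominus>\<^bsub>ZmodX n\<^esub> X_pow n 1) (reduce_poly n f) (reduce_poly n f) \<longleftrightarrow>
    dvd_mod (int n) f ([:0, 1:] ^ k - [:0, 1:])"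
proof -
  interpret P: UP_cring "Zmod n" "ZmodX n" using UP_cring_Zmod[OF assms(1)] .
  define a where "a = reduce_poly n ([:0, 1:] ^ k - [:0, 1:])"
  define b where "b = reduce_poly n f"
  have a: "X_pow n k \<ominus>\<^bsub>ZmodX n\<^esub> X_pow n 1 = a"
    using assms by (simp add: a_def X_pow_eq_reduce_poly reduce_poly_diff)
  have closed: "a \<in> carrier (ZmodX n)" "b \<in> carrier (ZmodX n)"
    using reduce_poly_closed[OF assms(1)] by (simp_all add: a_def b_def)
  have "Idl\<^bsub>ZmodX n\<^esub> {a, b} = Idl\<^bsub>ZmodX n\<^esub> {b} \<longleftrightarrow> a \<in> Idl\<^bsub>ZmodX n\<^esub> {b}"
  proof
    assume "Idl\<^bsub>ZmodX n\<^esub> {a, b} = Idl\<^bsub>ZmodX n\<^esub> {b}"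
    then show "a \<in> Idl\<^bsub>ZmodX n\<^esub> {b}"
      using P.P.genideal_self[of "{a, b}"] closed by auto
  next
    assume "a \<in> Idl\<^bsub>ZmodX n\<^esub> {b}"
    then have "Idl\<^bsub>ZmodX n\<^esub> {a, b} \<subseteq> Idl\<^bsub>ZmodX n\<^esub> {b}"
      using closed P.P.genideal_self'[of b]
      by (intro P.P.genideal_minimal P.P.genideal_ideal) auto
    moreover have "Idl\<^bsub>ZmodX n\<^esub> {b} \<subseteq> Idl\<^bsub>ZmodX n\<^esub> {a, b}"
      using closed P.P.genideal_self[of "{a, b}"]
      by (intro P.P.genideal_minimal P.P.genideal_ideal) auto
    ultimately show "Idl\<^bsub>ZmodX n\<^esub> {a, b} = Idl\<^bsub>ZmodX n\<^esub> {b}" by simp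
  qed
  also have "\<dots> \<longleftrightarrow> (\<exists>q\<in>carrier (ZmodX n). a = q \<otimes>\<^bsub>ZmodX n\<^esub> b)"
    unfolding P.P.cgenideal_eq_genideal[OF closed(2), symmetric] cgenideal_def by auto
  also have "\<dots> \<longleftrightarrow> dvd_mod (int n) f ([:0, 1:] ^ k - [:0, 1:])"
    unfolding dvd_mod_iff_reduce_poly[OF assms(1)] a_def b_def ..
  finally show ?thesis
    using monic_mod_reduce_poly[OF assms(1)] monic_X_power_minus_X[OF assms(2)] assms(3)
    unfolding is_gcmd_def a by (simp add: a_def b_def)
qed

text \<open>For \<open>F\<^sub>2 = 1\<close> condition (3) asks only that the substituted polynomial
  belong to the ring.\<close>

lemma subst_X_pow_closed:
  assumes "n > 1" "g \<in> carrier (ZmodX n)"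
  shows "subst_X_pow n g k \<in> carrier (ZmodX n)"
proof -
  interpret R: residues "int n" "Zmod n" using residues_int[OF assms(1)] .
  interpret P: UP_cring "Zmod n" "ZmodX n" using UP_cring_Zmod[OF assms(1)] .
  have "UP_pre_univ_prop (Zmod n) (ZmodX n) (\<lambda>a. up_ring.monom (ZmodX n) a 0)"
    using P.const_ring_hom R.cring P.UP_cring by (intro UP_pre_univ_propI) auto
  then interpret H: UP_pre_univ_prop "Zmod n" "ZmodX n" "\<lambda>a. up_ring.monom (ZmodX n) a 0" "ZmodX n"
    by simp
  have "X_pow n k \<in> carrier (ZmodX n)"
    using assms(1) by (simp add: X_pow_eq_reduce_poly reduce_poly_closed)
  from H.eval_ring_hom[OF this] show ?thesis
    unfolding subst_X_pow_def using assms(2) by (auto dest: ring_hom_closed)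
qed

text \<open>Condition (4) with Jacobi symbol \<open>1\<close> forces \<open>deg F\<^sub>2 = 0\<close>, so that \<open>F\<^sub>1 = f\<close>.\<close>

lemma frobenius_pseudoprime2_plus_iff:
  assumes "n > 1" "\<not> prime n"
  shows "frobenius_pseudoprime2 n f \<and> jacobi (quadratic_discr f) n = 1 \<longleftrightarrow>
    Polynomial.degree f = 2 \<and> lead_coeff f = 1 \<and>
    gcd (int n) (poly f 0 * quadratic_discr f) = 1 \<and> jacobi (quadratic_discr f) n = 1 \<and>
    dvd_mod (int n) f ([:0, 1:] ^ n - [:0, 1:])"
  (is "?L \<longleftrightarrow> ?R")
proof
  interpret R: residues "int n" "Zmod n" using residues_int[OF assms(1)] .
  interpret P: UP_cring "Zmod n" "ZmodX n" using UP_cring_Zmod[OF assms(1)] .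
  {
    assume L: ?L
    then obtain F\<^sub>1 f\<^sub>1 F\<^sub>2 f\<^sub>2 where
      f: "Polynomial.degree f = 2" "lead_coeff f = 1"
        "gcd (int n) (poly f 0 * quadratic_discr f) = 1" and
      gcmd1: "is_gcmd n (X_pow n n \<ominus>\<^bsub>ZmodX n\<^esub> X_pow n 1) (reduce_poly n f) F\<^sub>1" and
      f1: "f\<^sub>1 \<in> carrier (ZmodX n)" "reduce_poly n f = F\<^sub>1 \<otimes>\<^bsub>ZmodX n\<^esub> f\<^sub>1" and
      gcmd2: "is_gcmd n (X_pow n (n\<^sup>2) \<ominus>\<^bsub>ZmodX n\<^esub> X_pow n 1) f\<^sub>1 F\<^sub>2" and
      f2: "f\<^sub>1 = F\<^sub>2 \<otimes>\<^bsub>ZmodX n\<^esub> f\<^sub>2" "f\<^sub>2 = \<one>\<^bsub>ZmodX n\<^esub>" and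
      ev: "even (deg (Zmod n) F\<^sub>2)" and
      sgn: "(-1) ^ (deg (Zmod n) F\<^sub>2 div 2) = jacobi (quadratic_discr f) n"
      unfolding frobenius_pseudoprime2_def by (elim conjE exE) (rule that)
    have F1: "F\<^sub>1 \<in> carrier (ZmodX n)" "up_ring.coeff (ZmodX n) F\<^sub>1 (deg (Zmod n) F\<^sub>1) = \<one>\<^bsub>Zmod n\<^esub>"
      using gcmd1 by (auto simp: is_gcmd_def monic_mod_def)
    have F2: "F\<^sub>2 \<in> carrier (ZmodX n)" "up_ring.coeff (ZmodX n) F\<^sub>2 (deg (Zmod n) F\<^sub>2) = \<one>\<^bsub>Zmod n\<^esub>"
      using gcmd2 by (auto simp: is_gcmd_def monic_mod_def)
    have eq: "reduce_poly n f = F\<^sub>1 \<otimes>\<^bsub>ZmodX n\<^esub> F\<^sub>2" using f1 f2 F2 by simp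
    obtain u\<^sub>1 where u1: "F\<^sub>1 = reduce_poly n u\<^sub>1" "lead_coeff u\<^sub>1 = 1"
      using gcmd1 monic_mod_lift[OF assms(1)] unfolding is_gcmd_def by blast
    obtain u\<^sub>2 where u2: "F\<^sub>2 = reduce_poly n u\<^sub>2" "lead_coeff u\<^sub>2 = 1"
      using gcmd2 monic_mod_lift[OF assms(1)] unfolding is_gcmd_def by blast
    \<comment> \<open>Degrees add for the monic lifts, so \<open>F\<^sub>2\<close> has degree at
      most 2. Degree 1 is odd, and degree 2 would give the sign -1.\<close>
    have monic: "lead_coeff (u\<^sub>1 * u\<^sub>2) = 1" using u1 u2 by (simp add: lead_coeff_mult)
    have "reduce_poly n f = reduce_poly n (u\<^sub>1 * u\<^sub>2)"
      using eq by (simp add: u1(1) u2(1) reduce_poly_mult[OF assms(1)])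
    then have "2 = Polynomial.degree (u\<^sub>1 * u\<^sub>2)"
      using deg_reduce_poly_monic[OF assms(1) f(2)] deg_reduce_poly_monic[OF assms(1) monic] f(1)
      by simp
    also have "\<dots> = Polynomial.degree u\<^sub>1 + Polynomial.degree u\<^sub>2"
      using u1 u2 by (intro degree_mult_eq) auto
    finally have "deg (Zmod n) F\<^sub>2 \<le> 2"
      unfolding u2(1) deg_reduce_poly_monic[OF assms(1) u2(2)] by simp
    moreover have "deg (Zmod n) F\<^sub>2 \<noteq> 2"
      using sgn L by auto
    ultimately have deg0: "deg (Zmod n) F\<^sub>2 = 0"
      using ev by (cases "deg (Zmod n) F\<^sub>2 = 1") auto
    then have "F\<^sub>2 = \<one>\<^bsub>ZmodX n\<^esub>"
      using P.deg_zero_impl_monom[OF F2(1) deg0] F2(2) by simp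
    then have "F\<^sub>1 = reduce_poly n f" using eq F1 by simp
    then show ?R
      using gcmd1 is_gcmd_self_iff[OF assms(1) assms(1) f(2)] f L by simp
  }
  assume R: ?R
  \<comment> \<open>For the converse the witnesses are \<open>F\<^sub>1 = f\<close> and
    \<open>f\<^sub>1 = F\<^sub>2 = f\<^sub>2 = 1\<close>.\<close>
  have "n\<^sup>2 > 1" using assms(1) by (rule one_less_power) simp
  have one: "lead_coeff (1 :: int poly) = 1" by simp
  have "is_gcmd n (X_pow n (n\<^sup>2) \<ominus>\<^bsub>ZmodX n\<^esub> X_pow n 1) \<one>\<^bsub>ZmodX n\<^esub> \<one>\<^bsub>ZmodX n\<^esub>"
    using is_gcmd_self_iff[OF assms(1) \<open>n\<^sup>2 > 1\<close> one]
    by (simp add: reduce_poly_one[OF assms(1)] dvd_imp_dvd_mod)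
  moreover have "is_gcmd n (X_pow n n \<ominus>\<^bsub>ZmodX n\<^esub> X_pow n 1) (reduce_poly n f) (reduce_poly n f)"
    using is_gcmd_self_iff[OF assms(1) assms(1)] R by blast
  moreover have "\<one>\<^bsub>ZmodX n\<^esub> divides\<^bsub>ZmodX n\<^esub> subst_X_pow n \<one>\<^bsub>ZmodX n\<^esub> n"
    using subst_X_pow_closed[OF assms(1)] by (auto simp: factor_def)
  moreover have "deg (Zmod n) \<one>\<^bsub>ZmodX n\<^esub> = 0" by simp
  ultimately show ?L
    unfolding frobenius_pseudoprime2_def using R assms reduce_poly_closed[OF assms(1), of f]
    by (intro conjI exI[of _ "reduce_poly n f"] exI[of _ "\<one>\<^bsub>ZmodX n\<^esub>"]) auto
qed

section \<open>Counting the liars\<close>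

text \<open>The constant coordinate of a positive power of \<open>x\<close> is a multiple of
  \<open>c\<close>; being 1 modulo \<open>m\<close>, it shows \<open>c\<close> to be a unit.\<close>

lemma unity_imp_coprime:
  assumes "unity N m b c" "N > 0"
  shows "coprime c m"
proof -
  obtain M where "N = Suc M" using assms by (cases N) auto
  then have "[c * (- xlin b c M) = 1] (mod m)"
    using assms by (simp add: unity_def cong_iff_dvd_diff)
  then show ?thesis by (metis coprime_iff_invertible_int)
qed

text \<open>If \<open>c\<close> is a unit, then so is \<open>x\<close> modulo the quadratic, and one
  factor \<open>x\<close> cancels.\<close>

lemma dvd_mod_X_power_minus_X_iff:
  assumes "coprime m c"
  shows "dvd_mod m [:c, b, 1:] ([:0, 1:] ^ Suc N - [:0, 1:]) \<longleftrightarrow> unity N m b c"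
proof -
  have "m dvd xconst b c (Suc N) \<longleftrightarrow> m dvd xlin b c N"
    using assms by (simp add: coprime_dvd_mult_right_iff)
  moreover have "m dvd xlin b c (Suc N) - 1 \<longleftrightarrow> m dvd xconst b c N - 1" if "m dvd xlin b c N"
  proof -
    have "xlin b c (Suc N) - 1 = (xconst b c N - 1) - b * xlin b c N" by simp
    moreover have "m dvd b * xlin b c N" using that by simp
    ultimately show ?thesis by (metis dvd_diff_right_iff dvd_diff_left_iff)
  qed
  ultimately show ?thesis
    unfolding unity_def using dvd_mod_X_power_iff[of m c b "Suc N" 0 1] by auto
qed

lemma liar_plus_iff:
  assumes "n > 1" "\<not> prime n"
  shows "frobenius_pseudoprime2 n f \<and> jacobi (quadratic_discr f) n = 1 \<longleftrightarrow>
    (\<exists>b c. f = [:c, b, 1:] \<and> unity (n - 1) (int n) b c \<and> coprime (int n) (b\<^sup>2 - 4 * c) \<and>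
      jacobi (b\<^sup>2 - 4 * c) n = 1)"
proof -
  have monic: "Polynomial.degree f = 2 \<and> lead_coeff f = 1 \<longleftrightarrow> (\<exists>b c. f = [:c, b, 1:])"
  proof
    assume f: "Polynomial.degree f = 2 \<and> lead_coeff f = 1"
    have "f = [:Polynomial.coeff f 0, Polynomial.coeff f 1, 1:]"
    proof (rule poly_eqI)
      fix i :: nat
      consider "i = 0" | "i = 1" | "i = 2" | "i > 2" by linarith
      then show "Polynomial.coeff f i =
          Polynomial.coeff [:Polynomial.coeff f 0, Polynomial.coeff f 1, 1:] i"
        using f by cases (auto simp: coeff_pCons coeff_eq_0 numeral_2_eq_2 split: nat.splits)
    qed
    then show "\<exists>b c. f = [:c, b, 1:]" by blast
  qed auto
  have quad: "gcd (int n) (poly [:c, b, 1:] 0 * quadratic_discr [:c, b, 1:]) = 1 \<and>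
      jacobi (quadratic_discr [:c, b, 1:]) n = 1 \<and>
      dvd_mod (int n) [:c, b, 1:] ([:0, 1:] ^ n - [:0, 1:]) \<longleftrightarrow>
    unity (n - 1) (int n) b c \<and> coprime (int n) (b\<^sup>2 - 4 * c) \<and> jacobi (b\<^sup>2 - 4 * c) n = 1" for b c
  proof -
    have disc: "quadratic_discr [:c, b, 1:] = b\<^sup>2 - 4 * c"
      by (simp add: quadratic_discr_def numeral_2_eq_2)
    have "gcd (int n) (c * (b\<^sup>2 - 4 * c)) = 1 \<longleftrightarrow> coprime (int n) c \<and> coprime (int n) (b\<^sup>2 - 4 * c)"
      by (simp flip: coprime_iff_gcd_eq_1)
    moreover have "coprime (int n) c" if "unity (n - 1) (int n) b c"
      using unity_imp_coprime[OF that] assms(1) by (simp add: coprime_commute)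
    moreover have "dvd_mod (int n) [:c, b, 1:] ([:0, 1:] ^ n - [:0, 1:]) \<longleftrightarrow> unity (n - 1) (int n) b c"
      if "coprime (int n) c"
      using dvd_mod_X_power_minus_X_iff[OF that, of b "n - 1"] assms(1) by simp
    ultimately show ?thesis by (auto simp: disc)
  qed
  show ?thesis
    unfolding frobenius_pseudoprime2_plus_iff[OF assms] using quad monic by metis
qed

lemma discriminant_mod_8:
  fixes b c :: int
  assumes "odd b" "odd c"
  shows "(b\<^sup>2 - 4 * c) mod 8 = 5"
proof -
  obtain x where x: "b = 2 * x + 1" using assms(1) by (elim oddE)
  obtain y where y: "c = 2 * y + 1" using assms(2) by (elim oddE)
  have "even (x * (x + 1))" by simp
  then obtain z where z: "x * (x + 1) = 2 * z" by (elim evenE)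
  have "b\<^sup>2 - 4 * c = 4 * (x * (x + 1)) - 8 * y - 3"
    by (simp add: x y power2_eq_square algebra_simps)
  also have "\<dots> = 5 + 8 * (z - y - 1)" by (simp add: z)
  finally have "(b\<^sup>2 - 4 * c) mod 8 = (5 + 8 * (z - y - 1)) mod 8" by (rule arg_cong)
  then show ?thesis by (simp only: mod_mult_self2) simp
qed

lemma prod_dvd_iff:
  fixes q :: "nat \<Rightarrow> int"
  assumes "\<And>i j. i < k \<Longrightarrow> j < k \<Longrightarrow> i \<noteq> j \<Longrightarrow> coprime (q i) (q j)"
  shows "(\<Prod>i<k. q i) dvd x \<longleftrightarrow> (\<forall>i<k. q i dvd x)"
  using assms
proof (induction k)
  case (Suc k)
  have "coprime (\<Prod>i<k. q i) (q k)" using Suc.prems by (intro prod_coprime_left) auto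
  then have "(\<Prod>i<k. q i) * q k dvd x \<longleftrightarrow> (\<Prod>i<k. q i) dvd x \<and> q k dvd x"
    by (meson divides_mult dvd_mult_left dvd_mult_right)
  then show ?case using Suc by (auto simp: less_Suc_eq)
qed simp

locale prime_factorization_of =
  fixes n k :: nat and p r :: "nat \<Rightarrow> nat"
  assumes composite: "n > 1" "\<not> prime n"
    and factorization: "n = (\<Prod>i<k. p i ^ r i)"
    and primes: "\<And>i. i < k \<Longrightarrow> prime (p i)"
    and distinct: "inj_on p {..<k}"
    and exponents: "\<And>i. i < k \<Longrightarrow> r i \<ge> 1"
begin

lemma int_n: "int n = (\<Prod>i<k. int (p i) ^ r i)"
  by (simp add: factorization)

lemma coprime_factors:
  assumes "i < k" "j < k" "i \<noteq> j"
  shows "coprime (int (p i) ^ r i) (int (p j) ^ r j)"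
proof -
  have "p i \<noteq> p j" using distinct assms by (auto dest: inj_onD)
  then have "coprime (p i) (p j)" using primes assms by (intro primes_coprime) auto
  then show ?thesis by simp
qed

lemma prime_dvd_n:
  assumes "i < k"
  shows "p i dvd n"
proof -
  have "p i dvd p i ^ r i" using exponents[OF assms] by (intro dvd_power) simp
  also have "\<dots> dvd n" unfolding factorization using assms by (intro dvd_prodI) simp_all
  finally show ?thesis .
qed

lemma prime_not_dvd_pred: "i < k \<Longrightarrow> \<not> p i dvd n - 1"
proof
  assume i: "i < k" "p i dvd n - 1"
  have "p i dvd n - (n - 1)" using prime_dvd_n[OF i(1)] i(2) by (rule dvd_diff_nat)
  also have "n - (n - 1) = 1" using composite(1) by simp
  finally show False using primes[OF i(1)] by simp
qed

text \<open>Only the factor at 2 needs the hypotheses: they make \<open>c\<close> and the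
  discriminant odd, hence the latter 5 modulo 8, which agrees with the constant -1 in
  \<open>kron\<close>.\<close>

lemma jacobi_eq_prod:
  assumes "unity (n - 1) (int n) b c" "coprime (int n) (b\<^sup>2 - 4 * c)"
  shows "jacobi (b\<^sup>2 - 4 * c) n = (\<Prod>i<k. kron (p i) (b\<^sup>2 - 4 * c) ^ r i)"
proof -
  let ?z = "b\<^sup>2 - 4 * c"
  \<comment> \<open>Exponents are reindexed by the primes themselves, as the multiplicity of a
    product of prime powers requires.\<close>
  define s where "s = (\<lambda>q. r (the_inv_into {..<k} p q))"
  have s: "s (p i) = r i" if "i < k" for i
    using that by (simp add: s_def the_inv_into_f_f[OF distinct])
  have n: "n = (\<Prod>q\<in>p ` {..<k}. q ^ s q)"
    unfolding factorization by (subst prod.reindex[OF distinct]) (simp add: s)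
  have mult: "multiplicity (p i) n = r i" if "i < k" for i
    unfolding n using that primes
    by (subst multiplicity_prod_prime_powers) (auto simp: s)
  have "prime_factors n = p ` {..<k}"
  proof (intro subset_antisym subsetI)
    fix q assume "q \<in> prime_factors n"
    then have q: "prime q" "q dvd n" by auto
    then obtain i where "i < k" "q dvd p i ^ r i"
      unfolding factorization using prime_dvd_prod_iff[of "{..<k}" q] by auto
    then have "q = p i" using q(1) primes prime_dvd_power primes_dvd_imp_eq by metis
    then show "q \<in> p ` {..<k}" using \<open>i < k\<close> by simp
  next
    fix q assume "q \<in> p ` {..<k}"
    then show "q \<in> prime_factors n"
      using primes prime_dvd_n composite by (auto simp: prime_factors_dvd)
  qed
  then have "jacobi ?z n = (\<Prod>i<k.
      (if p i = 2 then (if even ?z then 0 else if ?z mod 8 \<in> {1, 7} then 1 else -1)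
       else Legendre ?z (int (p i))) ^ multiplicity (p i) n)"
    unfolding jacobi_def by (simp only: prod.reindex[OF distinct] comp_def)
  also have "\<dots> = (\<Prod>i<k. kron (p i) ?z ^ r i)"
  proof (rule prod.cong)
    fix i assume "i \<in> {..<k}"
    then have i: "i < k" by simp
    have "(if even ?z then 0 else if ?z mod 8 \<in> {1, 7} then 1 else -1) = (-1 :: int)" if "p i = 2"
    proof -
      have "even (int n)" using prime_dvd_n[OF i] that by simp
      moreover have "coprime c (int n)" using unity_imp_coprime[OF assms(1)] composite by simp
      ultimately have "odd c" "odd ?z"
        using assms(2) not_coprimeI[of 2] by (metis odd_one, metis odd_one)
      then have "?z mod 8 = 5" by (intro discriminant_mod_8) auto
      then show ?thesis using \<open>odd ?z\<close> by simp
    qed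
    then show "(if p i = 2 then (if even ?z then 0 else if ?z mod 8 \<in> {1, 7} then 1 else -1)
        else Legendre ?z (int (p i))) ^ multiplicity (p i) n = kron (p i) ?z ^ r i"
      using mult[OF i] by (simp add: kron_def)
  qed simp
  finally show ?thesis .
qed

text \<open>The symbol is written through \<open>kron\<close>, whose value depends only on residues
  modulo \<open>n\<close>, so that representatives can replace integral lifts.\<close>

definition liar_params :: "(int \<times> int) set" where
  "liar_params = {(b, c) \<in> {0..<int n} \<times> {0..<int n}. unity (n - 1) (int n) b c \<and>
     coprime (int n) (b\<^sup>2 - 4 * c) \<and> (\<Prod>i<k. kron (p i) (b\<^sup>2 - 4 * c) ^ r i) = 1}"

lemma L2_plus_eq_card: "L2_plus n = card liar_params"
proof -
  define Good where "Good = (\<lambda>b c. unity (n - 1) (int n) b c \<and> coprime (int n) (b\<^sup>2 - 4 * c) \<and>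
     (\<Prod>i<k. kron (p i) (b\<^sup>2 - 4 * c) ^ r i) = 1)"
  have Good_cong: "Good (b mod int n) (c mod int n) \<longleftrightarrow> Good b c" for b c
  proof -
    have disc: "[(b mod int n)\<^sup>2 - 4 * (c mod int n) = b\<^sup>2 - 4 * c] (mod int n)"
      by (intro cong_diff cong_pow cong_mult) simp_all
    then have "coprime (int n) ((b mod int n)\<^sup>2 - 4 * (c mod int n)) \<longleftrightarrow> coprime (int n) (b\<^sup>2 - 4 * c)"
      using cong_imp_coprime cong_sym by (metis coprime_commute)
    moreover have "kron (p i) ((b mod int n)\<^sup>2 - 4 * (c mod int n)) = kron (p i) (b\<^sup>2 - 4 * c)"
      if "i < k" for i
      using Legendre_cong[OF cong_dvd_modulus[OF disc]] prime_dvd_n[OF that] by (simp add: kron_def)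
    moreover have "unity (n - 1) (int n) (b mod int n) (c mod int n) \<longleftrightarrow> unity (n - 1) (int n) b c"
      by (rule unity_cong) simp_all
    ultimately show ?thesis by (simp add: Good_def)
  qed
  let ?red = "\<lambda>(b, c). reduce_poly n [:c, b, 1:]"
  have red: "?red (b mod int n, c mod int n) = ?red (b, c)" for b c
    by (auto simp: reduce_poly_def coeff_pCons split: nat.splits)
  have "{f. frobenius_pseudoprime2 n f \<and> jacobi (quadratic_discr f) n = 1} = {[:c, b, 1:] | b c. Good b c}"
    unfolding liar_plus_iff[OF composite] Good_def using jacobi_eq_prod by auto
  also have "reduce_poly n ` \<dots> = ?red ` liar_params"
  proof (intro subset_antisym subsetI)
    fix x assume "x \<in> reduce_poly n ` {[:c, b, 1:] | b c. Good b c}"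
    then obtain b c where bc: "x = ?red (b, c)" "Good b c" by auto
    then have "(b mod int n, c mod int n) \<in> liar_params"
      using composite Good_cong[of b c] by (simp add: liar_params_def Good_def)
    moreover have "x = ?red (b mod int n, c mod int n)" by (simp only: bc(1) red)
    ultimately show "x \<in> ?red ` liar_params" by (rule rev_image_eqI)
  next
    fix x assume "x \<in> ?red ` liar_params"
    then show "x \<in> reduce_poly n ` {[:c, b, 1:] | b c. Good b c}"
      by (auto simp: liar_params_def Good_def)
  qed
  finally have "L2_plus n = card (?red ` liar_params)" by (simp add: L2_plus_def)
  also have "\<dots> = card liar_params"
  proof (rule card_image, rule inj_onI)
    fix x y assume xy: "x \<in> liar_params" "y \<in> liar_params" "?red x = ?red y"
    obtain b c b' c' where eq: "x = (b, c)" "y = (b', c')" by (cases x, cases y)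
    have "reduce_poly n [:c, b, 1:] i = reduce_poly n [:c', b', 1:] i" for i
      using xy(3) by (simp add: eq)
    from this[of 0] this[of 1] show "x = y"
      using xy(1,2) by (simp add: eq reduce_poly_def liar_params_def)
  qed
  finally show ?thesis .
qed

text \<open>Both conditions modulo \<open>n\<close> split over the prime powers. Exponents
  \<open>e = 0\<close> give their indicator, and \<open>e = r\<close> multiplies it by the Jacobi
  symbol.\<close>

lemma prod_weight:
  "(\<Prod>i<k. weight (n - 1) (p i) (r i) (e i) b c) =
    (if unity (n - 1) (int n) b c \<and> coprime (int n) (b\<^sup>2 - 4 * c)
     then real_of_int (\<Prod>i<k. kron (p i) (b\<^sup>2 - 4 * c) ^ e i) else 0)"
proof -
  have "int n dvd x \<longleftrightarrow> (\<forall>i<k. int (p i) ^ r i dvd x)" for x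
    unfolding int_n by (rule prod_dvd_iff) (rule coprime_factors)
  then have unity: "unity (n - 1) (int n) b c \<longleftrightarrow> (\<forall>i<k. unity (n - 1) (int (p i) ^ r i) b c)"
    unfolding unity_def by blast
  have "coprime (int n) (b\<^sup>2 - 4 * c) \<longleftrightarrow> (\<forall>i<k. \<not> int (p i) dvd b\<^sup>2 - 4 * c)"
  proof
    assume *: "coprime (int n) (b\<^sup>2 - 4 * c)"
    show "\<forall>i<k. \<not> int (p i) dvd b\<^sup>2 - 4 * c"
    proof (intro allI impI notI)
      fix i assume i: "i < k" "int (p i) dvd b\<^sup>2 - 4 * c"
      have "int (p i) dvd int n" using prime_dvd_n[OF i(1)] by simp
      then have "is_unit (int (p i))" using coprime_common_divisor[OF *] i(2) by blast
      then show False using primes[OF i(1)] by simp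
    qed
  next
    assume *: "\<forall>i<k. \<not> int (p i) dvd b\<^sup>2 - 4 * c"
    show "coprime (int n) (b\<^sup>2 - 4 * c)"
      unfolding int_n
    proof (rule prod_coprime_left)
      fix i assume "i \<in> {..<k}"
      then have "coprime (int (p i)) (b\<^sup>2 - 4 * c)"
        using primes * by (intro prime_imp_coprime) auto
      then show "coprime (int (p i) ^ r i) (b\<^sup>2 - 4 * c)" by simp
    qed
  qed
  then show ?thesis
    using unity by (auto simp: weight_def intro!: prod.cong)
qed

lemma card_liar_params:
  "real (card liar_params) =
    1 / 2 * (\<Sum>b\<in>{0..<int n}. \<Sum>c\<in>{0..<int n}. \<Prod>i<k. weight (n - 1) (p i) (r i) 0 b c) +
    1 / 2 * (\<Sum>b\<in>{0..<int n}. \<Sum>c\<in>{0..<int n}. \<Prod>i<k. weight (n - 1) (p i) (r i) (r i) b c)"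
proof -
  have ind: "(if (b, c) \<in> liar_params then 1 else 0) =
      1 / 2 * (\<Prod>i<k. weight (n - 1) (p i) (r i) 0 b c) +
      1 / 2 * (\<Prod>i<k. weight (n - 1) (p i) (r i) (r i) b c)"
    if "b \<in> {0..<int n}" "c \<in> {0..<int n}" for b c
  proof (cases "unity (n - 1) (int n) b c \<and> coprime (int n) (b\<^sup>2 - 4 * c)")
    case True
    let ?J = "\<Prod>i<k. kron (p i) (b\<^sup>2 - 4 * c) ^ r i"
    \<comment> \<open>The discriminant is prime to \<open>n\<close>, so no local symbol is 0 and
      \<open>(1 + J) / 2\<close> is the indicator of \<open>J = 1\<close>.\<close>
    have "\<bar>?J\<bar> = 1"
    proof -
      have "\<bar>kron (p i) (b\<^sup>2 - 4 * c)\<bar> = 1" if "i < k" for i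
      proof -
        have "\<not> is_unit (int (p i))" using prime_gt_1_nat[OF primes[OF that]] by simp
        moreover have "int (p i) dvd int n" using prime_dvd_n[OF that] by simp
        ultimately have "\<not> int (p i) dvd b\<^sup>2 - 4 * c"
          using True coprime_common_divisor by blast
        then show ?thesis by (simp add: kron_def Legendre_def cong_0_iff)
      qed
      then show ?thesis by (simp add: abs_prod power_abs)
    qed
    then have "?J = 1 \<or> ?J = - 1" by linarith
    then show ?thesis
      using True that unfolding prod_weight by (auto simp: liar_params_def simp del: of_int_prod)
  next
    case False
    then show ?thesis unfolding prod_weight by (auto simp: liar_params_def)
  qed
  have "liar_params \<subseteq> {0..<int n} \<times> {0..<int n}" by (auto simp: liar_params_def)
  then have "real (card liar_params) =
      (\<Sum>x\<in>{0..<int n} \<times> {0..<int n}. if x \<in> liar_params then 1 else 0)"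
    by (simp add: sum.If_cases Int_absorb1)
  also have "\<dots> = (\<Sum>b\<in>{0..<int n}. \<Sum>c\<in>{0..<int n}. if (b, c) \<in> liar_params then 1 else 0)"
    by (simp only: sum.cartesian_product case_prod_eta) simp
  also have "\<dots> = (\<Sum>b\<in>{0..<int n}. \<Sum>c\<in>{0..<int n}.
      1 / 2 * (\<Prod>i<k. weight (n - 1) (p i) (r i) 0 b c) +
      1 / 2 * (\<Prod>i<k. weight (n - 1) (p i) (r i) (r i) b c))"
    by (intro sum.cong refl ind) auto
  finally show ?thesis by (simp only: sum.distrib sum_distrib_left)
qed

lemma sum_prod_weight:
  "(\<Sum>b\<in>{0..<int n}. \<Sum>c\<in>{0..<int n}. \<Prod>i<k. weight (n - 1) (p i) (r i) (e i) b c) =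
    (\<Prod>i<k. ((real (gcd (n - 1) (p i - 1)))\<^sup>2 - real (gcd (n - 1) (p i - 1))) / 2 +
      (- 1) ^ e i * ((real (gcd (n - 1) ((p i)\<^sup>2 - 1)) - real (gcd (n - 1) (p i - 1))) / 2))"
proof -
  have "(\<Sum>b\<in>{0..<int n}. \<Sum>c\<in>{0..<int n}. \<Prod>i<k. weight (n - 1) (p i) (r i) (e i) b c) =
    (\<Prod>i<k. \<Sum>b\<in>{0..<int (p i) ^ r i}. \<Sum>c\<in>{0..<int (p i) ^ r i}.
      weight (n - 1) (p i) (r i) (e i) b c)"
    unfolding int_n
  proof (rule sum_square_prod)
    fix i assume "i < k"
    then show "int (p i) ^ r i > 0" using primes by (simp add: prime_gt_0_nat)
  next
    fix i b c assume "i < k"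
    then show "weight (n - 1) (p i) (r i) (e i) (b mod int (p i) ^ r i) (c mod int (p i) ^ r i) =
        weight (n - 1) (p i) (r i) (e i) b c"
      using exponents by (intro weight_cong) simp_all
  qed (rule coprime_factors)
  also have "\<dots> = (\<Prod>i<k. ((real (gcd (n - 1) (p i - 1)))\<^sup>2 - real (gcd (n - 1) (p i - 1))) / 2 +
      (- 1) ^ e i * ((real (gcd (n - 1) ((p i)\<^sup>2 - 1)) - real (gcd (n - 1) (p i - 1))) / 2))"
    by (intro prod.cong refl sum_weight_prime_power primes prime_not_dvd_pred exponents) simp_all
  finally show ?thesis .
qed

end

theorem theorem3p4:
  fixes n k :: nat and p r g h :: "nat \<Rightarrow> nat" and A B :: "nat \<Rightarrow> real"
  assumes composite: "n > 1" "\<not> prime n"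
    and factorization: "n = (\<Prod>i<k. p i ^ r i)"
    and primes: "\<And>i. i < k \<Longrightarrow> prime (p i)"
    and distinct: "inj_on p {..<k}"
    and exponents: "\<And>i. i < k \<Longrightarrow> r i \<ge> 1"
    and g: "\<And>i. i < k \<Longrightarrow> g i = gcd (n - 1) (p i - 1)"
    and h: "\<And>i. i < k \<Longrightarrow> h i = gcd (n - 1) ((p i)\<^sup>2 - 1)"
    and A: "\<And>i. i < k \<Longrightarrow> A i = 1 / 2 * ((real (g i))\<^sup>2 - real (g i))"
    and B: "\<And>i. i < k \<Longrightarrow> B i = 1 / 2 * (real (h i) - real (g i))"
  shows "real (L2_plus n) =
    1 / 2 * (\<Prod>i<k. A i + B i) +
    1 / 2 * ((\<Prod>i\<in>{i. i < k \<and> even (r i)}. A i + B i) *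
             (\<Prod>i\<in>{i. i < k \<and> odd (r i)}. A i - B i))"
proof -
  interpret prime_factorization_of n k p r
    by unfold_locales (use assms in auto)
  have sum: "(\<Sum>b\<in>{0..<int n}. \<Sum>c\<in>{0..<int n}. \<Prod>i<k. weight (n - 1) (p i) (r i) (e i) b c) =
      (\<Prod>i<k. A i + (- 1) ^ e i * B i)" for e
    unfolding sum_prod_weight by (rule prod.cong) (simp_all add: A B g h)
  \<comment> \<open>The local symbol enters to the power \<open>r i\<close>, so its sign survives
    exactly at odd exponents.\<close>
  have "(\<Prod>i<k. A i + (- 1) ^ r i * B i) = (\<Prod>i<k. if even (r i) then A i + B i else A i - B i)"
    by (rule prod.cong) auto
  also have "\<dots> = (\<Prod>i\<in>{i. i < k \<and> even (r i)}. A i + B i) *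
      (\<Prod>i\<in>{i. i < k \<and> odd (r i)}. A i - B i)"
    by (subst prod.If_cases) (simp_all add: Int_def)
  finally show ?thesis
    unfolding L2_plus_eq_card card_liar_params sum[of "\<lambda>_. 0"] sum[of r] by simp
qed

end
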